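(* Let $d \geq 2$ be fixed and let $p = p(m) \in (0,1]$ (fixed or depending on $m$) be such that $p\, m^{1/(d-1)} \to \infty$ as $m \to \infty$. Then with probability tending to $1$ as $m \to \infty$, the Hausdorff distance between $Q \sim P_2(d,m,p)$ and the unit sphere is at most \[O\left(\frac{\log^2(pm)\,(\log m)^{2/(d-1)}}{p^2 m^{2/(d-1)}} + \left(\frac{\log(p m^d)}{m}\right)^{2/(d-1)}\right),\] where the implied constant depends only on $d$.
   Context: Model $P_1(d,m)$: $P$ is the convex hull of $m$ independent uniformly random points on the unit sphere $S^{d-1} \subset \mathbb{R}^d$. Its dual is $P^{\circ} = \{y : \langle x, y\rangle \leq 1 \ \forall x \in P\}$. Model $\mathcal{B}(P', p)$: include each vertex of the polytope $P'$ independently with probability $p$ and take the convex hull of the included vertices. Model $P_2(d,m,p)$: $Q \sim \mathcal{B}(P^{\circ}, p)$ with $P \sim P_1(d,m)$.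
   Formalization: The Hausdorff distance is taken between the boundary of Q and the unit sphere, since the solid polytope Q typically contains the origin and is then at distance at least 1 from the sphere (e.g. for p = 1). *)

theory Defs
  imports "HOL-Probability.Probability"
begin

text \<open>
  The uniform distribution on the unit sphere, as the normalised cone measure: the radial
  projection of the uniform distribution on the unit ball. It is a Borel measure on the ambient
  space that is concentrated on the sphere.
\<close>

definition uniform_sphere :: "'a::euclidean_space measure" where
  "uniform_sphere = distr (uniform_measure lborel (ball 0 1)) borel sgn"

lemma emeasure_lborel_unit_ball:
  "emeasure lborel (ball (0::'a::euclidean_space) 1) \<noteq> 0"
  "emeasure lborel (ball (0::'a::euclidean_space) 1) \<noteq> \<infinity>"
proof -
  have "measure lborel (ball (0::'a) 1) > 0"
    by (rule content_ball_pos) simp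
  then show "emeasure lborel (ball (0::'a::euclidean_space) 1) \<noteq> 0"
    by (auto simp: measure_def)
  show "emeasure lborel (ball (0::'a::euclidean_space) 1) \<noteq> \<infinity>"
    using emeasure_lborel_ball_finite[of "0::'a" 1] by simp
qed

lemma borel_measurable_sgn_euclidean:
  "(sgn :: 'a::euclidean_space \<Rightarrow> 'a) \<in> borel_measurable borel"
  unfolding sgn_div_norm[abs_def] by measurable

lemma measurable_sgn_uniform_ball:
  "(sgn :: 'a::euclidean_space \<Rightarrow> 'a) \<in> borel_measurable (uniform_measure lborel (ball 0 1))"
proof -
  have "sets (uniform_measure lborel (ball (0::'a) 1)) = sets borel" by simp
  from measurable_cong_sets[OF this refl] show ?thesis
    using borel_measurable_sgn_euclidean by blast
qed

lemma sets_uniform_sphere [simp, measurable_cong]: "sets uniform_sphere = sets borel"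
  by (simp add: uniform_sphere_def)

lemma space_uniform_sphere [simp]: "space uniform_sphere = UNIV"
  by (simp add: uniform_sphere_def)

lemma prob_space_uniform_sphere: "prob_space (uniform_sphere :: 'a::euclidean_space measure)"
proof -
  interpret prob_space "uniform_measure lborel (ball (0::'a) 1)"
    using emeasure_lborel_unit_ball by (rule prob_space_uniform_measure)
  show ?thesis
    unfolding uniform_sphere_def
    by (rule prob_space_distr) (rule measurable_sgn_uniform_ball)
qed

lemma AE_uniform_sphere: "AE x in (uniform_sphere :: 'a::euclidean_space measure). x \<in> sphere 0 1"
proof -
  have "AE x in lborel. (x::'a) \<noteq> 0"
    by (rule AE_lborel_singleton)
  then have "AE x in uniform_measure lborel (ball (0::'a) 1). x \<noteq> 0"
    by (auto intro!: AE_uniform_measureI)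
  then have "AE x in uniform_measure lborel (ball (0::'a) 1). sgn x \<in> sphere 0 1"
    by (rule AE_mp) (auto simp: norm_sgn)
  then show ?thesis
    unfolding uniform_sphere_def
    by (subst AE_distr_iff) (auto simp: measurable_sgn_uniform_ball)
qed

lemma emeasure_uniform_sphere:
  fixes A :: "'a::euclidean_space set"
  assumes "A \<in> sets borel"
  shows "emeasure uniform_sphere A
       = emeasure lborel {x \<in> ball 0 1. sgn x \<in> A} / emeasure lborel (ball (0::'a) 1)"
proof -
  have "sgn -` A \<in> sets borel"
    using measurable_sets[OF borel_measurable_sgn_euclidean assms] by simp
  then show ?thesis
    unfolding uniform_sphere_def using assms
    by (subst emeasure_distr)
       (auto simp: measurable_sgn_uniform_ball
             intro!: arg_cong2[where f="(/)"] arg_cong2[where f=emeasure])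
qed

lemma uniform_sphere_rotation_invariant:
  fixes f :: "real^'n::{finite,wellorder} \<Rightarrow> real^'n::{finite,wellorder}"
  assumes f: "orthogonal_transformation f"
  shows "distr uniform_sphere borel f = uniform_sphere"
proof (rule measure_eqI)
  show "sets (distr uniform_sphere borel f) = sets uniform_sphere" by simp
next
  fix A assume "A \<in> sets (distr uniform_sphere borel f)"
  then have A: "A \<in> sets borel" by simp
  have lin: "linear f" and nf: "\<And>x. norm (f x) = norm x"
    using f by (auto simp: orthogonal_transformation)
  have fm: "f \<in> borel_measurable borel"
    using linear_continuous_on[of f UNIV] lin
    by (intro borel_measurable_continuous_onI) (simp add: linear_conv_bounded_linear)
  have fmu: "f \<in> borel_measurable uniform_sphere"
    using fm measurable_cong_sets[OF sets_uniform_sphere refl] by blast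
  have fA: "f -` A \<in> sets borel"
    using measurable_sets[OF fm A] by simp
  have sgnf: "sgn (f x) = f (sgn x)" for x
    by (simp add: sgn_div_norm nf linear_cmul[OF lin])
  define B where "B = {x \<in> ball 0 1. sgn x \<in> A}"
  define B' where "B' = {x \<in> ball 0 1. sgn x \<in> f -` A}"
  have meas: "{x \<in> ball 0 1. sgn x \<in> C} \<in> sets borel" if "C \<in> sets borel"
    for C :: "(real^'n::{finite,wellorder}) set"
  proof -
    have "sgn -` C \<in> sets borel"
      using measurable_sets[OF borel_measurable_sgn_euclidean that] by simp
    moreover have "{x \<in> ball 0 1. sgn x \<in> C} = ball 0 1 \<inter> sgn -` C" by auto
    ultimately show ?thesis by simp
  qed
  have Bm: "B \<in> sets borel" "B' \<in> sets borel"
    unfolding B_def B'_def by (rule meas[OF A], rule meas[OF fA])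
  have lm: "C \<in> lmeasurable" if "C \<in> sets borel" "C \<subseteq> ball 0 1"
    for C :: "(real^'n::{finite,wellorder}) set"
    using that by (intro bounded_set_imp_lmeasurable) (auto intro: bounded_subset)
  have im: "f ` B' = B"
  proof
    show "f ` B' \<subseteq> B" by (auto simp: B_def B'_def nf sgnf)
    show "B \<subseteq> f ` B'"
    proof
      fix y assume y: "y \<in> B"
      obtain x where "y = f x" using orthogonal_transformation_surj[OF f] by (metis surjD)
      then show "y \<in> f ` B'" using y by (auto simp: B_def B'_def nf sgnf)
    qed
  qed
  have "B' \<in> lmeasurable" "B \<in> lmeasurable"
    using Bm by (auto intro!: lm simp: B_def B'_def)
  moreover have "measure lebesgue B = measure lebesgue B'"
    using measure_orthogonal_image[OF f \<open>B' \<in> lmeasurable\<close>] im by simp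
  ultimately have "emeasure lebesgue B = emeasure lebesgue B'"
    by (simp only: emeasure_eq_measure2)
  then have "emeasure lborel B = emeasure lborel B'"
    using Bm by simp
  then show "emeasure (distr uniform_sphere borel f) A = emeasure uniform_sphere A"
    using A fA fmu
    by (simp add: emeasure_distr emeasure_uniform_sphere B_def B'_def)
qed

definition dual :: "'a::euclidean_space set \<Rightarrow> 'a set" where
  "dual P = {y. \<forall>x\<in>P. x \<bullet> y \<le> 1}"

definition vertices :: "'a::euclidean_space set \<Rightarrow> 'a set" where
  "vertices P = {v. v extreme_point_of P}"

text \<open>
  The law of the convex hull of a random set of vertices, each of them kept independently with
  probability \<open>p\<close>.
\<close>

definition random_subpolytope :: "'a::euclidean_space set \<Rightarrow> real \<Rightarrow> 'a set pmf" where
  "random_subpolytope P p =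
     map_pmf (\<lambda>keep. convex hull {v \<in> vertices P. keep v})
             (Pi_pmf (vertices P) False (\<lambda>_. bernoulli_pmf p))"

text \<open>\<open>Pi_pmf\<close> is only meaningful over a finite index set; the dual of a polytope, even an
  unbounded one, has finitely many vertices.\<close>

lemma finite_vertices_dual:
  fixes X :: "'a::euclidean_space set"
  assumes "finite X"
  shows "finite (vertices (dual (convex hull X)))"
proof -
  have "dual (convex hull X) = (\<Inter>x\<in>X. {y. x \<bullet> y \<le> 1})"
  proof
    show "dual (convex hull X) \<subseteq> (\<Inter>x\<in>X. {y. x \<bullet> y \<le> 1})"
      by (auto simp: dual_def hull_inc)
    have "x \<bullet> y \<le> 1" if y: "\<forall>x\<in>X. x \<bullet> y \<le> 1" and x: "x \<in> convex hull X" for x y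
    proof -
      have "convex hull X \<subseteq> {x. y \<bullet> x \<le> 1}"
        using y by (intro hull_minimal convex_halfspace_le) (auto simp: inner_commute)
      then show ?thesis using x by (auto simp: inner_commute)
    qed
    then show "(\<Inter>x\<in>X. {y. x \<bullet> y \<le> 1}) \<subseteq> dual (convex hull X)"
      by (auto simp: dual_def)
  qed
  moreover have "polyhedron (\<Inter>x\<in>X. {y. x \<bullet> y \<le> 1})"
    using assms by (intro polyhedron_Inter) (auto intro: polyhedron_halfspace_le)
  ultimately show ?thesis
    unfolding vertices_def by (simp add: finite_polyhedron_extreme_points)
qed

text \<open>
  The probability that \<open>Q \<in> E\<close>, where \<open>Q\<close> keeps each vertex of the dual of \<open>P\<close> independently with
  probability \<open>p\<close> and \<open>P\<close> is the convex hull of \<open>m\<close> independent uniform points on the sphere: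
  the conditional probability given the points, averaged over the points. For an integrand that is
  not measurable, \<open>nn_integral\<close> is the lower integral, so that a lower bound
  on this quantity never holds merely for lack of measurability.
\<close>

definition prob_P2 :: "nat \<Rightarrow> real \<Rightarrow> 'a::euclidean_space set set \<Rightarrow> ennreal" where
  "prob_P2 m p E =
     (\<integral>\<^sup>+ x. emeasure (measure_pmf (random_subpolytope (dual (convex hull (x ` {..<m}))) p)) E
        \<partial>(\<Pi>\<^sub>M i\<in>{..<m}. uniform_sphere))"

text \<open>The values are extended reals, so that the distance from a nonempty set to the empty set
  is infinite. The distance between a solid polytope \<open>Q\<close> and the unit sphere is meant as
  \<open>hausdorff_distance (frontier Q) (sphere 0 1)\<close>, since an interior point of \<open>Q\<close> near the centre is
  at distance about 1 from the sphere however well \<open>Q\<close> approximates the ball.\<close>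

definition hausdorff_distance :: "'a::metric_space set \<Rightarrow> 'a set \<Rightarrow> ennreal" where
  "hausdorff_distance A B =
     max (SUP a\<in>A. INF b\<in>B. ennreal (dist a b)) (SUP b\<in>B. INF a\<in>A. ennreal (dist a b))"

end

theory Submission
  imports Defs "HOL-Real_Asymp.Real_Asymp"
begin

text \<open>
  Write \<open>d\<close> for the dimension and let \<open>r\<close> be a large multiple of \<open>(ln m / m) powr (1 / (d - 1))\<close>.
  With high probability the sample meets every cap of radius \<open>2 r\<close>, so the dual \<open>P\<^sup>\<circ>\<close> lies in the
  ball of radius \<open>1 + 4 r\<^sup>2\<close>. For a unit vector \<open>w\<close>, a vertex \<open>v\<close> of \<open>P\<^sup>\<circ>\<close> maximising the inner
  product with \<open>w\<close> has inner product at least 1 with \<open>w\<close>, hence is within \<open>4 r\<close> of \<open>w\<close>.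
  Applying this to \<open>K\<close> points spaced \<open>9 r\<close> along a great circle yields \<open>K\<close> distinct vertices in a cap
  of radius of order \<open>r K\<close>. For \<open>K\<close> about \<open>d ln (p m) / p\<close>, a union bound over a net shows that a
  vertex is kept in every such cap, and then \<open>Q\<close> contains the ball of radius \<open>1 - O((r K)\<^sup>2)\<close>. Here
  \<open>(r K)\<^sup>2\<close> is of the order of the first summand of the claimed bound.

  If \<open>r K\<close> is not small, the claimed bound exceeds 3 and it suffices that \<open>Q\<close> is nonempty, i.e. that
  \<open>P\<^sup>\<circ>\<close> has many more than \<open>1 / p\<close> vertices. For \<open>d \<ge> 3\<close> these come from a two-parameter grid on the
  sphere. For \<open>d = 2\<close> every sample point supports an edge of \<open>P\<^sup>\<circ>\<close> and every vertex lies on at most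
  two tangent lines, so there are at least \<open>m / 2\<close> vertices.
\<close>

section \<open>Caps and nets of the sphere\<close>

text \<open>After rescaling \<open>y\<close> by \<open>1 / t\<close>, radial projection moves it by
  |norm z - 1|, which is at most its distance to the unit vector \<open>u\<close>; the triangle
  inequality then costs the factor 2. For \<open>y = 0\<close> one has \<open>sgn 0 = 0\<close>, and
  the claim reads 1 <= 2.\<close>

lemma dist_sgn_le:
  fixes y u :: "'a::euclidean_space"
  assumes "norm u = 1" "t > 0"
  shows "dist (sgn y) u \<le> 2 * dist y (t *\<^sub>R u) / t"
proof (cases "y = 0")
  case True
  then show ?thesis using assms by (simp add: dist_norm)
next
  case False
  define z where "z = (1 / t) *\<^sub>R y"
  have z: "sgn y = sgn z" "z \<noteq> 0" using assms False
    by (auto simp: z_def sgn_scaleR)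
  have "sgn z - z = (1 - norm z) *\<^sub>R sgn z"
    using z(2) by (simp add: sgn_div_norm algebra_simps)
  then have "norm (sgn z - z) = \<bar>norm u - norm z\<bar>"
    using z(2) assms by (simp add: norm_sgn)
  also have "\<dots> \<le> norm (z - u)" by (metis norm_minus_commute norm_triangle_ineq3)
  finally have "dist (sgn z) u \<le> 2 * norm (z - u)"
    using dist_triangle[of "sgn z" u z] by (simp add: dist_norm)
  moreover have "norm (z - u) = dist y (t *\<^sub>R u) / t"
  proof -
    have "z - u = (1 / t) *\<^sub>R (y - t *\<^sub>R u)" using assms by (simp add: z_def algebra_simps)
    then show ?thesis using assms by (simp add: dist_norm)
  qed
  ultimately show ?thesis using z by simp
qed

text \<open>The cone over the cap holds at least \<open>1 / r\<close> disjoint balls of radius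
  \<open>r / 8\<close>, strung along the ray through \<open>u\<close>. Each takes the fraction
  \<open>(r / 8) ^ DIM('a)\<close> of the unit ball, and their number lowers the exponent of
  \<open>r\<close> by one.\<close>

lemma measure_uniform_sphere_ball_ge:
  fixes u :: "'a::euclidean_space"
  assumes u: "norm u = 1" and r: "0 < r" "r \<le> 1"
  shows "measure uniform_sphere (ball u r) \<ge> r ^ (DIM('a) - 1) / 8 ^ DIM('a)"
proof -
  \<comment> \<open>The last index \<open>n - 1\<close> is the floor of \<open>1 / r\<close>, so
    \<open>n\<close> is at least \<open>1 / r\<close> while every \<open>t j\<close> with
    \<open>j < n\<close> stays in [1/2, 3/4], away from the origin and from the unit sphere.\<close>
  define n where "n = Suc (nat \<lfloor>1 / r\<rfloor>)"
  define t where "t j = 1 / 2 + real j * r / 4" for j :: nat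
  define B where "B j = ball (t j *\<^sub>R u) (r / 8)" for j
  define S where "S = {x \<in> ball 0 1. sgn x \<in> ball u r}"
  have n: "real n \<ge> 1 / r" unfolding n_def using r by linarith
  have jr: "real j * r \<le> 1" if "j < n" for j
  proof -
    have "real j \<le> 1 / r" using that r unfolding n_def
      by (simp add: less_Suc_eq_le le_nat_iff le_floor_iff)
    then show ?thesis using r by (simp add: field_simps)
  qed
  have sub: "B j \<subseteq> S" if "j < n" for j
  proof
    fix y assume "y \<in> B j"
    then have y: "dist y (t j *\<^sub>R u) < r / 8" by (simp add: B_def dist_commute)
    have t: "1 / 2 \<le> t j" "t j \<le> 3 / 4" using jr[OF that] r by (auto simp: t_def)
    have "dist (sgn y) u \<le> 2 * dist y (t j *\<^sub>R u) / t j"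
      using dist_sgn_le[OF u, of "t j" y] t by simp
    also have "\<dots> \<le> 2 * (r / 8) / (1 / 2)"
      using y t r by (intro frac_le) auto
    finally have "dist (sgn y) u < r" using r by simp
    moreover have "norm y < 1"
    proof -
      have "norm y \<le> norm (t j *\<^sub>R u) + norm (y - t j *\<^sub>R u)" by (metis norm_triangle_sub)
      also have "\<dots> < 3 / 4 + r / 8" using y t u by (simp add: dist_norm)
      finally show ?thesis using r by simp
    qed
    ultimately show "y \<in> S" by (simp add: S_def dist_commute)
  qed
  \<comment> \<open>Consecutive centres are \<open>r / 4\<close> apart, the sum of two radii; the
    balls are open, so they may touch.\<close>
  have disj: "disjoint_family_on B {..<n}"
    unfolding disjoint_family_on_def
  proof (intro ballI impI)
    fix i j :: nat assume "i \<noteq> j"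
    then have "\<bar>real i - real j\<bar> \<ge> 1" by linarith
    moreover have "dist (t i *\<^sub>R u) (t j *\<^sub>R u) = \<bar>real i - real j\<bar> * r / 4"
    proof -
      have "t i *\<^sub>R u - t j *\<^sub>R u = ((real i - real j) * r / 4) *\<^sub>R u"
        by (simp add: t_def algebra_simps diff_divide_distrib)
      then show ?thesis using u r by (simp add: dist_norm abs_mult)
    qed
    ultimately have "dist (t i *\<^sub>R u) (t j *\<^sub>R u) \<ge> r / 8 + r / 8" using r
      by (simp add: field_simps)
    then show "B i \<inter> B j = {}" unfolding B_def by (intro disjoint_ballI)
  qed
  have Sm: "S \<in> sets borel"
  proof -
    have "sgn -` ball u r \<in> sets borel"
      using measurable_sets[OF borel_measurable_sgn_euclidean, of "ball u r"] by simp
    moreover have "S = ball 0 1 \<inter> sgn -` ball u r" by (auto simp: S_def)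
    ultimately show ?thesis by simp
  qed
  have Sf: "S \<in> fmeasurable lborel"
  proof (rule fmeasurableI2)
    show "ball (0::'a) 1 \<in> fmeasurable lborel" by (rule fmeasurableI) (use emeasure_lborel_ball_finite[of "0::'a" 1] in auto)
  qed (use Sm in \<open>auto simp: S_def\<close>)
  define V where "V = unit_ball_vol (real DIM('a))"
  have V: "V > 0" by (simp add: V_def)
  have "real n * (V * (r / 8) ^ DIM('a)) = (\<Sum>j<n. measure lborel (B j))"
    using r by (simp add: B_def V_def content_ball)
  also have "\<dots> = measure lborel (\<Union>j<n. B j)"
  proof (rule measure_finite_Union[symmetric])
    show "emeasure lborel (B j) \<noteq> \<infinity>" for j
      using emeasure_lborel_ball_finite[of "t j *\<^sub>R u" "r / 8"] by (simp add: B_def)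
  qed (use disj in \<open>auto simp: B_def[abs_def]\<close>)
  also have "\<dots> \<le> measure lborel S"
    by (rule measure_mono_fmeasurable) (use sub Sf in \<open>auto simp: B_def intro!: sets.finite_UN\<close>)
  finally have le: "real n * (V * (r / 8) ^ DIM('a)) \<le> measure lborel S" .
  have "measure uniform_sphere (ball u r) = measure lborel S / V"
  proof -
    have "emeasure uniform_sphere (ball u r) = emeasure lborel S / emeasure lborel (ball (0::'a) 1)"
      unfolding S_def by (rule emeasure_uniform_sphere) simp
    also have "\<dots> = ennreal (measure lborel S) / ennreal V"
      using Sf content_ball[of 1 "0::'a"] emeasure_lborel_unit_ball[where 'a='a]
      by (simp add: emeasure_eq_measure2 V_def emeasure_eq_ennreal_measure)
    also have "\<dots> = ennreal (measure lborel S / V)" using V by (simp add: divide_ennreal)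
    finally show ?thesis using V by (simp add: measure_def)
  qed
  also have "\<dots> \<ge> real n * (r / 8) ^ DIM('a)" using le V by (simp add: field_simps)
  moreover have "real n * (r / 8) ^ DIM('a) \<ge> 1 / r * (r / 8) ^ DIM('a)"
    using n r by (intro mult_right_mono) auto
  moreover have "1 / r * (r / 8) ^ DIM('a) = r ^ (DIM('a) - 1) / 8 ^ DIM('a)"
  proof -
    have "r ^ DIM('a) = r * r ^ (DIM('a) - 1)" by (metis DIM_positive power_minus_mult mult.commute)
    then show ?thesis using r by (simp add: power_divide)
  qed
  ultimately show ?thesis by linarith
qed

text \<open>A largest \<open>r\<close>-separated subset of the sphere is a net, since an uncovered
  point could be added to it. Balls of half the radius around its points are disjoint, and the lower
  bound on their mass limits their number.\<close>

lemma sphere_net: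
  assumes r: "0 < r" "r \<le> 1"
  obtains N :: "'a::euclidean_space set" where "finite N" "N \<subseteq> sphere 0 1"
    "\<And>u. norm u = 1 \<Longrightarrow> \<exists>n\<in>N. dist u n < r" "real (card N) \<le> 16 ^ DIM('a) / r ^ (DIM('a) - 1)"
proof -
  interpret prob_space "uniform_sphere :: 'a measure" by (rule prob_space_uniform_sphere)
  define sep where "sep N \<longleftrightarrow> finite N \<and> N \<subseteq> sphere (0::'a) 1 \<and> (\<forall>x\<in>N. \<forall>y\<in>N. x \<noteq> y \<longrightarrow> dist x y \<ge> r)" for N
  define b where "b = 16 ^ DIM('a) / r ^ (DIM('a) - 1)"
  have bound: "real (card N) \<le> b" if "sep N" for N
  proof -
    have fin: "finite N" using that by (simp add: sep_def)
    have disj: "disjoint_family_on (\<lambda>x. ball x (r / 2)) N"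
      using that by (auto simp: disjoint_family_on_def sep_def intro!: disjoint_ballI)
    have "real (card N) * ((r / 2) ^ (DIM('a) - 1) / 8 ^ DIM('a))
        = (\<Sum>x\<in>N. (r / 2) ^ (DIM('a) - 1) / 8 ^ DIM('a))" by simp
    also have "\<dots> \<le> (\<Sum>x\<in>N. prob (ball x (r / 2)))"
      using that r by (intro sum_mono measure_uniform_sphere_ball_ge) (auto simp: sep_def)
    also have "\<dots> = prob (\<Union>x\<in>N. ball x (r / 2))"
      by (rule finite_measure_finite_Union[symmetric]) (use fin disj in auto)
    also have "\<dots> \<le> 1" by simp
    finally have "real (card N) \<le> 8 ^ DIM('a) * 2 ^ (DIM('a) - 1) / r ^ (DIM('a) - 1)"
      using r by (simp add: power_divide field_simps)
    also have "\<dots> \<le> 8 ^ DIM('a) * 2 ^ DIM('a) / r ^ (DIM('a) - 1)"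
      using r by (intro divide_right_mono mult_left_mono power_increasing) auto
    also have "(8::real) ^ DIM('a) * 2 ^ DIM('a) = 16 ^ DIM('a)"
      unfolding power_mult_distrib[symmetric] by simp
    also have "16 ^ DIM('a) / r ^ (DIM('a) - 1) = b" by (simp add: b_def)
    finally show ?thesis .
  qed
  have 1: "sep {}" by (simp add: sep_def)
  \<comment> \<open>The bound on the size of separated sets makes a largest one exist.\<close>
  have 2: "\<forall>N. sep N \<longrightarrow> card N < Suc (nat \<lfloor>b\<rfloor>)"
    using bound by (auto simp: less_Suc_eq_le intro: le_nat_floor)
  have "\<exists>N. sep N \<and> (\<forall>N'. sep N' \<longrightarrow> card N' \<le> card N)"
    by (rule ex_has_greatest_nat[OF 1 2])
  then obtain N where N: "sep N" "\<And>N'. sep N' \<Longrightarrow> card N' \<le> card N" by metis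
  show thesis
  proof (rule that[of N])
    show "finite N" "N \<subseteq> sphere 0 1" using N(1) by (auto simp: sep_def)
    show "real (card N) \<le> 16 ^ DIM('a) / r ^ (DIM('a) - 1)" using bound[OF N(1)] by (simp add: b_def)
    fix u :: 'a assume u: "norm u = 1"
    show "\<exists>n\<in>N. dist u n < r"
    proof (rule ccontr)
      assume "\<not> ?thesis"
      then have far: "\<And>n. n \<in> N \<Longrightarrow> dist u n \<ge> r" by force
      then have "u \<notin> N" using r by fastforce
      moreover have "sep (insert u N)" using N(1) far u by (auto simp: sep_def dist_commute)
      ultimately show False using N(2)[of "insert u N"] N(1) by (auto simp: sep_def)
    qed
  qed
qed

section \<open>Hausdorff distance and vertices of the dual\<close>

lemma hausdorff_distance_leI:
  assumes "\<And>a. a \<in> A \<Longrightarrow> \<exists>b\<in>B. dist a b \<le> c" "\<And>b. b \<in> B \<Longrightarrow> \<exists>a\<in>A. dist a b \<le> c"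
  shows "hausdorff_distance A B \<le> ennreal c"
  unfolding hausdorff_distance_def
proof (intro max.boundedI SUP_least)
  fix a assume "a \<in> A"
  then obtain b where "b \<in> B" "dist a b \<le> c" using assms(1) by blast
  then show "(INF b\<in>B. ennreal (dist a b)) \<le> ennreal c"
    by (intro INF_lower2[of b]) (auto intro: ennreal_leI)
next
  fix b assume "b \<in> B"
  then obtain a where "a \<in> A" "dist a b \<le> c" using assms(2) by blast
  then show "(INF a\<in>A. ennreal (dist a b)) \<le> ennreal c"
    by (intro INF_lower2[of a]) (auto intro: ennreal_leI)
qed

text \<open>Both directions move points along rays. A frontier point lies in the shell between the
  two radii and is compared with its \<open>sgn\<close>. On the ray through a sphere point, the
  segment across the shell starts in \<open>Q\<close> and meets the frontier by
  connectedness.\<close>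

lemma hausdorff_distance_frontier_sphere_le:
  fixes Q :: "'a::euclidean_space set"
  assumes a: "0 \<le> a" "a < 1" and inner: "cball 0 (1 - a) \<subseteq> Q" and outer: "Q \<subseteq> cball 0 (1 + a)"
  shows "hausdorff_distance (frontier Q) (sphere 0 1) \<le> ennreal a"
proof (rule hausdorff_distance_leI)
  have fr: "1 - a \<le> norm x" "norm x \<le> 1 + a" if "x \<in> frontier Q" for x
  proof -
    have "x \<in> closure Q" using that by (simp add: frontier_def)
    then show "norm x \<le> 1 + a" using closure_minimal[OF outer] by auto
    have "ball 0 (1 - a) \<subseteq> interior Q"
      using inner by (intro interior_maximal) (auto intro: order.trans[OF ball_subset_cball])
    then show "1 - a \<le> norm x" using that by (force simp: frontier_def)
  qed
  fix x assume x: "x \<in> frontier Q"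
  have "x \<noteq> 0" using fr(1)[OF x] a by auto
  moreover have "dist x (sgn x) = \<bar>norm x - 1\<bar>" if "x \<noteq> 0" for x :: 'a
  proof -
    have "x - sgn x = (norm x - 1) *\<^sub>R sgn x" using that by (simp add: sgn_div_norm algebra_simps)
    then show ?thesis using that by (simp add: dist_norm norm_sgn)
  qed
  ultimately show "\<exists>b\<in>sphere 0 1. dist x b \<le> a"
    using fr[OF x] by (intro bexI[of _ "sgn x"]) (auto simp: norm_sgn)
next
  fix b :: 'a assume b: "b \<in> sphere 0 1"
  define S where "S = closed_segment ((1 - a) *\<^sub>R b) ((1 + a) *\<^sub>R b)"
  have param: "\<exists>t\<ge>1 - a. t \<le> 1 + a \<and> t *\<^sub>R b \<in> frontier Q"
  proof (cases "(1 + a) *\<^sub>R b \<in> frontier Q")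
    case True
    then show ?thesis using a by (intro exI[of _ "1 + a"]) auto
  next
    case False
    \<comment> \<open>An interior point at radius \<open>1 + a\<close> would give points of
      \<open>Q\<close> beyond that radius.\<close>
    have "(1 + a) *\<^sub>R b \<notin> interior Q"
    proof
      assume "(1 + a) *\<^sub>R b \<in> interior Q"
      then obtain e where e: "e > 0" "ball ((1 + a) *\<^sub>R b) e \<subseteq> Q" by (meson mem_interior)
      have "(1 + a) *\<^sub>R b + (e / 2) *\<^sub>R b \<in> ball ((1 + a) *\<^sub>R b) e" using e b by (simp add: dist_norm)
      moreover have "(1 + a) *\<^sub>R b + (e / 2) *\<^sub>R b = (1 + a + e / 2) *\<^sub>R b" by (simp add: algebra_simps)
      ultimately have "(1 + a + e / 2) *\<^sub>R b \<in> cball 0 (1 + a)" using e(2) outer by (metis subsetD)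
      then show False using e a b by auto
    qed
    then have "(1 + a) *\<^sub>R b \<notin> Q" using False by (metis DiffI closure_subset frontier_def subsetD)
    moreover have "(1 - a) *\<^sub>R b \<in> Q" using inner a b by (auto simp: subset_iff)
    ultimately have "S \<inter> frontier Q \<noteq> {}" unfolding S_def
      by (intro connected_Int_frontier) auto
    then obtain x where x: "x \<in> S" "x \<in> frontier Q" by blast
    obtain c where c: "0 \<le> c" "c \<le> 1" "x = (1 - c) *\<^sub>R ((1 - a) *\<^sub>R b) + c *\<^sub>R ((1 + a) *\<^sub>R b)"
      using x(1) by (auto simp: S_def in_segment)
    have "x = (1 + (2 * c - 1) * a) *\<^sub>R b" unfolding c(3) scaleR_scaleR scaleR_left_distrib[symmetric]
      by (simp add: algebra_simps)
    moreover have "\<bar>(2 * c - 1) * a\<bar> \<le> a" using a c by (auto simp: abs_mult intro!: mult_left_le_one_le)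
    ultimately show ?thesis using x by (intro exI[of _ "1 + (2 * c - 1) * a"]) auto
  qed
  then obtain t where t: "1 - a \<le> t" "t \<le> 1 + a" "t *\<^sub>R b \<in> frontier Q" by blast
  have "t *\<^sub>R b - b = (t - 1) *\<^sub>R b" by (simp add: algebra_simps)
  then have "dist (t *\<^sub>R b) b \<le> a" using t b by (simp add: dist_norm)
  then show "\<exists>x\<in>frontier Q. dist x b \<le> a" using t by blast
qed

text \<open>This serves the regime where the claimed bound is at least 3. An empty frontier would
  make the distance infinite; a nonempty bounded set has a nonempty one.\<close>

lemma hausdorff_distance_frontier_sphere_le_3:
  fixes Q :: "'a::euclidean_space set"
  assumes "Q \<noteq> {}" "Q \<subseteq> cball 0 2"
  shows "hausdorff_distance (frontier Q) (sphere 0 1) \<le> ennreal 3"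
proof (rule hausdorff_distance_leI)
  have d: "dist a b \<le> 3" if "a \<in> frontier Q" "b \<in> sphere 0 1" for a b
  proof -
    have "a \<in> closure Q" using that by (simp add: frontier_def)
    then have "a \<in> cball 0 2" using closure_minimal[OF assms(2)] by auto
    then show ?thesis using that dist_triangle[of a b 0] by (simp add: dist_commute)
  qed
  obtain i :: 'a where "i \<in> Basis" using nonempty_Basis by blast
  then have "i \<in> sphere 0 1" by simp
  then show "\<exists>b\<in>sphere 0 1. dist a b \<le> 3" if "a \<in> frontier Q" for a using d that by blast
  have "Q \<noteq> UNIV" using assms(2) bounded_subset[OF bounded_cball] not_bounded_UNIV by blast
  then have "frontier Q \<noteq> {}" using assms(1) by (simp add: frontier_eq_empty)
  then show "\<exists>a\<in>frontier Q. dist a b \<le> 3" if "b \<in> sphere 0 1" for b using d that by blast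
qed

text \<open>A point \<open>z\<close> of the ball outside \<open>Q\<close> is strictly separated from
  \<open>Q\<close> by a hyperplane with normal \<open>a\<close>. In the direction
  \<open>- sgn a\<close> all of \<open>Q\<close> then has inner product below \<open>norm z\<close>,
  against the support bound.\<close>

lemma cball_subset_if_support_ge:
  fixes Q :: "'a::euclidean_space set"
  assumes "convex Q" "closed Q" and supp: "\<And>u. norm u = 1 \<Longrightarrow> \<exists>v\<in>Q. v \<bullet> u \<ge> h"
  shows "cball 0 h \<subseteq> Q"
proof
  fix z :: 'a assume z: "z \<in> cball 0 h"
  show "z \<in> Q"
  proof (rule ccontr)
    assume "z \<notin> Q"
    then obtain a b where ab: "a \<bullet> z < b" "\<forall>x\<in>Q. b < a \<bullet> x"
      using separating_hyperplane_closed_point[OF assms(1,2)] by blast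
    \<comment> \<open>For empty \<open>Q\<close> the separating normal could be zero; the hypothesis
      in one direction rules this out.\<close>
    obtain i :: 'a where "i \<in> Basis" using nonempty_Basis by blast
    then have "Q \<noteq> {}" using supp[of i] by auto
    then have "a \<noteq> 0" using ab by auto
    then obtain v where v: "v \<in> Q" "v \<bullet> (- sgn a) \<ge> h" using supp[of "- sgn a"] by (auto simp: norm_sgn)
    have "v \<bullet> (- sgn a) = - (a \<bullet> v) / norm a"
      by (simp add: sgn_div_norm inner_commute divide_inverse)
    then have "h \<le> - (a \<bullet> v) / norm a" using v by simp
    then have "h * norm a \<le> - (a \<bullet> v)" using \<open>a \<noteq> 0\<close> by (subst (asm) pos_le_divide_eq) auto
    moreover have "- (a \<bullet> z) \<le> norm a * h"
      using Cauchy_Schwarz_ineq2[of a z] z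
      by (smt (verit, best) mem_cball_0 mult_left_mono norm_ge_zero)
    ultimately show False using ab v(1) by (smt (verit, best) mult.commute)
  qed
qed

lemma dual_convex_hull: "dual (convex hull X) = {y. \<forall>x\<in>X. x \<bullet> y \<le> 1}"
proof -
  have "x \<bullet> y \<le> 1" if y: "\<forall>x\<in>X. x \<bullet> y \<le> 1" and x: "x \<in> convex hull X" for x y :: 'a
  proof -
    have "convex hull X \<subseteq> {x. y \<bullet> x \<le> 1}"
      using y by (intro hull_minimal convex_halfspace_le) (auto simp: inner_commute)
    then show ?thesis using x by (auto simp: inner_commute)
  qed
  then show ?thesis by (auto simp: dual_def hull_inc)
qed

lemma convex_dual: "convex (dual P)" and closed_dual: "closed (dual P)"
proof -
  have "dual P = (\<Inter>x\<in>P. {y. x \<bullet> y \<le> 1})" by (auto simp: dual_def)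
  then show "convex (dual P)" "closed (dual P)"
    by (auto intro!: convex_INT convex_halfspace_le closed_INT closed_halfspace_le)
qed

text \<open>The maximisers of the linear functional form a nonempty compact face, and an extreme
  point of a face is extreme in the whole set.\<close>

lemma vertex_maximizing:
  fixes S :: "'a::euclidean_space set"
  assumes "compact S" "convex S" "y \<in> S"
  obtains v where "v \<in> vertices S" "w \<bullet> y \<le> w \<bullet> v"
proof -
  have "continuous_on S (\<lambda>x. w \<bullet> x)" by (intro continuous_intros)
  then obtain z where z: "z \<in> S" "\<And>x. x \<in> S \<Longrightarrow> w \<bullet> x \<le> w \<bullet> z"
    using continuous_attains_sup[of S "\<lambda>x. w \<bullet> x"] assms by blast
  define F where "F = S \<inter> {x. w \<bullet> x = w \<bullet> z}"
  have face: "F face_of S" unfolding F_def using assms z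
    by (intro face_of_Int_supporting_hyperplane_le) auto
  have "compact F" unfolding F_def by (intro compact_Int_closed assms closed_hyperplane)
  moreover have "convex F" using face face_of_imp_convex by blast
  moreover have "F \<noteq> {}" using z by (auto simp: F_def)
  ultimately obtain v where "v extreme_point_of F"
    using extreme_point_exists_convex by blast
  then have "v extreme_point_of S" "v \<in> F" using extreme_point_of_face[OF face] by auto
  then show thesis using that[of v] z(2)[OF assms(3)] by (auto simp: vertices_def F_def)
qed

text \<open>A point \<open>x\<close> of \<open>X\<close> within \<open>2 * r\<close> of the
  direction of \<open>y\<close> has inner product at least \<open>1 - 2 * r\<^sup>2\<close> with it,
  so the constraint at \<open>x\<close> gives \<open>norm y * (1 - 2 * r\<^sup>2) \<le> 1\<close>.
  For \<open>r \<le> 1 / 2\<close> the reciprocal is at most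
  \<open>1 + 4 * r\<^sup>2\<close>.\<close>

lemma norm_dual_le:
  fixes X :: "'a::euclidean_space set"
  assumes X: "X \<subseteq> sphere 0 1" and cov: "\<And>u. norm u = 1 \<Longrightarrow> \<exists>x\<in>X. dist x u \<le> 2 * r"
    and r: "0 \<le> r" "r \<le> 1 / 2" and y: "y \<in> dual (convex hull X)"
  shows "norm y \<le> 1 + 4 * r\<^sup>2"
proof (cases "y = 0")
  case False
  then obtain x where x: "x \<in> X" "dist x (sgn y) \<le> 2 * r" using cov[of "sgn y"] by (auto simp: norm_sgn)
  have nx: "norm x = 1" using x X by auto
  have "(dist x (sgn y))\<^sup>2 \<le> (2 * r)\<^sup>2" using x by (intro power_mono) auto
  moreover have "(dist x (sgn y))\<^sup>2 = 2 - 2 * (x \<bullet> sgn y)"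
  proof -
    have "x \<bullet> x = 1" "sgn y \<bullet> sgn y = 1" using nx False by (simp_all add: norm_sgn flip: norm_eq_1)
    then show ?thesis
      by (simp add: dist_norm power2_norm_eq_inner inner_diff_left inner_diff_right inner_commute)
  qed
  ultimately have "1 - 2 * r\<^sup>2 \<le> x \<bullet> sgn y" by (simp add: power_mult_distrib)
  then have "(1 - 2 * r\<^sup>2) * norm y \<le> (x \<bullet> sgn y) * norm y" by (intro mult_right_mono) auto
  also have "\<dots> = x \<bullet> y" using False by (simp add: sgn_div_norm)
  also have "\<dots> \<le> 1" using y x by (auto simp: dual_convex_hull)
  finally have 1: "(1 - 2 * r\<^sup>2) * norm y \<le> 1" .
  have r2: "r\<^sup>2 \<le> 1 / 4" using power_mono[of r "1/2" 2] r by (simp add: power_divide)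
  have "1 \<le> (1 - 2 * r\<^sup>2) * (1 + 4 * r\<^sup>2)"
  proof -
    have "(1 - 2 * r\<^sup>2) * (1 + 4 * r\<^sup>2) = 1 + 2 * r\<^sup>2 * (1 - 4 * r\<^sup>2)" by (simp add: algebra_simps)
    then show ?thesis using r2 by simp
  qed
  with 1 have "(1 - 2 * r\<^sup>2) * norm y \<le> (1 - 2 * r\<^sup>2) * (1 + 4 * r\<^sup>2)" by linarith
  then show ?thesis using r2 by (simp add: mult_le_cancel_left)
qed simp

lemma compact_dual:
  fixes P :: "'a::euclidean_space set"
  assumes "\<And>y. y \<in> dual P \<Longrightarrow> norm y \<le> b"
  shows "compact (dual P)"
  using assms closed_dual by (auto simp: compact_eq_bounded_closed bounded_iff)

text \<open>Since \<open>w\<close> lies in the dual, a vertex maximising the inner product with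
  \<open>w\<close> is on or beyond the tangent hyperplane at \<open>w\<close>. The norm bound leaves
  only a thin cap there: the squared distance to \<open>w\<close> is at most
  \<open>(1 + 4 * r\<^sup>2)\<^sup>2 - 1\<close>.\<close>

lemma vertex_of_dual_near:
  fixes X :: "'a::euclidean_space set"
  assumes X: "X \<subseteq> sphere 0 1" and bd: "\<And>y. y \<in> dual (convex hull X) \<Longrightarrow> norm y \<le> 1 + 4 * r\<^sup>2"
    and r: "0 \<le> r" "r \<le> 1 / 2" and w: "norm w = 1"
  obtains v where "v \<in> vertices (dual (convex hull X))" "1 \<le> norm v" "dist v w \<le> 4 * r"
proof -
  have "w \<in> dual (convex hull X)"
  proof -
    have "x \<bullet> w \<le> 1" if "x \<in> X" for x
      using that X w norm_cauchy_schwarz[of x w] by auto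
    then show ?thesis by (simp add: dual_convex_hull)
  qed
  then obtain v where v: "v \<in> vertices (dual (convex hull X))" "w \<bullet> w \<le> w \<bullet> v"
    using vertex_maximizing[OF compact_dual[OF bd] convex_dual] by blast
  have wv: "w \<bullet> v \<ge> 1" using v w by (simp add: norm_eq_1)
  have nv: "norm v \<le> 1 + 4 * r\<^sup>2" using v bd by (auto simp: vertices_def extreme_point_of_def)
  have r2: "r\<^sup>2 \<le> 1 / 4" using power_mono[of r "1/2" 2] r by (simp add: power_divide)
  have "(dist v w)\<^sup>2 = (norm v)\<^sup>2 + 1 - 2 * (w \<bullet> v)"
    using w by (simp add: dist_norm power2_norm_eq_inner inner_diff_left inner_diff_right
        inner_commute norm_eq_1)
  also have "\<dots> \<le> (1 + 4 * r\<^sup>2)\<^sup>2 - 1" using wv power_mono[OF nv, of 2] by (smt (verit) norm_ge_zero)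
  also have "\<dots> = 16 * r\<^sup>2 - 8 * r\<^sup>2 * (1 - 2 * r\<^sup>2)" by (simp add: power2_eq_square algebra_simps)
  also have "\<dots> \<le> (4 * r)\<^sup>2" using r2 by (simp add: power_mult_distrib)
  finally have "dist v w \<le> 4 * r" by (rule power2_le_imp_le) (use r in simp)
  moreover have "1 \<le> norm v" using wv norm_cauchy_schwarz[of w v] w by simp
  ultimately show thesis using that v by blast
qed

text \<open>The unit vectors \<open>sqrt (1 - \<bar>z\<bar>\<^sup>2) u + z\<close> with \<open>z\<close> orthogonal to \<open>u\<close> are at least as far apart as the \<open>z\<close>,
  so vertices close to them are distinct.\<close>

lemma many_vertices_near:
  fixes X A :: "'a::euclidean_space set"
  assumes X: "X \<subseteq> sphere 0 1" and bd: "\<And>y. y \<in> dual (convex hull X) \<Longrightarrow> norm y \<le> 1 + 4 * r\<^sup>2"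
    and r: "0 \<le> r" "r \<le> 1 / 2" and u: "norm u = 1"
    and A: "\<And>z. z \<in> A \<Longrightarrow> u \<bullet> z = 0" "\<And>z. z \<in> A \<Longrightarrow> norm z \<le> b" and b: "b \<le> 1"
    and sep: "\<And>z z'. z \<in> A \<Longrightarrow> z' \<in> A \<Longrightarrow> z \<noteq> z' \<Longrightarrow> dist z z' > 8 * r"
  shows "\<exists>W \<subseteq> vertices (dual (convex hull X)). card W = card A \<and>
    (\<forall>v\<in>W. 1 \<le> norm v \<and> dist v u \<le> 2 * b + 4 * r)"
proof -
  define w where "w z = sqrt (1 - (norm z)\<^sup>2) *\<^sub>R u + z" for z
  have nz: "(norm z)\<^sup>2 \<le> 1" if "z \<in> A" for z
    using power_mono[of "norm z" 1 2] A(2)[OF that] b by simp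
  have uu: "u \<bullet> u = 1" using u by (simp add: norm_eq_1)
  have nw: "norm (w z) = 1" if "z \<in> A" for z
    unfolding norm_eq_1 w_def using A(1)[OF that] nz[OF that] uu
    by (simp add: inner_add_left inner_add_right inner_commute power2_norm_eq_inner flip: power2_eq_square)
  have "\<exists>v. v \<in> vertices (dual (convex hull X)) \<and> 1 \<le> norm v \<and> dist v (w z) \<le> 4 * r" if "z \<in> A" for z
    using vertex_of_dual_near[OF X bd r nw[OF that]] by metis
  then obtain f where f: "\<And>z. z \<in> A \<Longrightarrow> f z \<in> vertices (dual (convex hull X)) \<and> 1 \<le> norm (f z) \<and> dist (f z) (w z) \<le> 4 * r"
    by metis
  have dw: "dist z z' \<le> dist (w z) (w z')" if "z \<in> A" "z' \<in> A" for z z'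
  proof -
    define c where "c = sqrt (1 - (norm z)\<^sup>2) - sqrt (1 - (norm z')\<^sup>2)"
    have *: "w z - w z' = c *\<^sub>R u + (z - z')" by (simp add: w_def c_def algebra_simps)
    have "u \<bullet> (z - z') = 0" using A(1) that by (simp add: inner_diff_right)
    then have "(norm (w z - w z'))\<^sup>2 = c\<^sup>2 + (norm (z - z'))\<^sup>2"
      unfolding * power2_norm_eq_inner using uu
      by (simp add: inner_add_left inner_add_right inner_commute power2_eq_square)
    then have "(norm (z - z'))\<^sup>2 \<le> (norm (w z - w z'))\<^sup>2" by simp
    then show ?thesis unfolding dist_norm by (rule power2_le_imp_le) simp
  qed
  \<comment> \<open>Two lifted points that share a vertex are each within \<open>4 * r\<close> of
    it, which is where the separation \<open>8 * r\<close> comes from.\<close>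
  have inj: "inj_on f A"
  proof (rule inj_onI, rule ccontr)
    fix z z' assume z: "z \<in> A" "z' \<in> A" "f z = f z'" "z \<noteq> z'"
    have "dist (w z) (w z') \<le> dist (f z) (w z) + dist (f z') (w z')"
      using z(3) dist_triangle3[of "w z" "w z'" "f z"] by simp
    also have "\<dots> \<le> 8 * r" using f[OF z(1)] f[OF z(2)] by linarith
    finally show False using sep[OF z(1,2,4)] dw[OF z(1,2)] by linarith
  qed
  have wu: "dist (w z) u \<le> 2 * b" if "z \<in> A" for z
  proof -
    \<comment> \<open>A number in [0, 1] is at most its square root; this makes the squared distance
      from \<open>w z\<close> to \<open>u\<close> quadratic in \<open>norm z\<close>.\<close>
    have s: "1 - (norm z)\<^sup>2 \<le> sqrt (1 - (norm z)\<^sup>2)"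
      using nz[OF that] by (intro real_le_rsqrt) (auto simp: power2_eq_square mult_left_le_one_le)
    have "(dist (w z) u)\<^sup>2 = 2 - 2 * (w z \<bullet> u)"
      using nw[OF that] u by (simp add: dist_norm power2_norm_eq_inner inner_diff_left inner_diff_right
        inner_commute norm_eq_1)
    also have "w z \<bullet> u = sqrt (1 - (norm z)\<^sup>2)"
      using A(1)[OF that] uu by (simp add: w_def inner_add_left inner_add_right inner_commute)
    also have "2 - 2 * sqrt (1 - (norm z)\<^sup>2) \<le> 2 * (norm z)\<^sup>2" using s by simp
    also have "\<dots> \<le> (2 * norm z)\<^sup>2" by (simp add: power_mult_distrib)
    finally have "dist (w z) u \<le> 2 * norm z" by (rule power2_le_imp_le) simp
    then show ?thesis using A(2)[OF that] by linarith
  qed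
  show ?thesis
  proof (intro exI[of _ "f ` A"] conjI ballI)
    show "f ` A \<subseteq> vertices (dual (convex hull X))" using f by blast
    show "card (f ` A) = card A" using inj by (rule card_image)
    fix v assume "v \<in> f ` A"
    then obtain z where z: "z \<in> A" "v = f z" by blast
    then show "1 \<le> norm v" "dist v u \<le> 2 * b + 4 * r"
      using f[OF z(1)] wu[OF z(1)] dist_triangle[of "f z" u "w z"] by auto
  qed
qed

section \<open>Random samples and random vertex sets\<close>

text \<open>The event is a product set with trivial factors off \<open>W\<close>, so independence
  gives exactly \<open>(1 - p) ^ card W\<close>.\<close>

lemma prob_none_kept_le:
  fixes p :: real
  assumes "finite V" "W \<subseteq> V" "0 \<le> p" "p \<le> 1"
  shows "measure_pmf.prob (Pi_pmf V False (\<lambda>_. bernoulli_pmf p)) {keep. \<forall>v\<in>W. \<not> keep v}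
    \<le> exp (- p * card W)"
proof -
  have fW: "finite W" using assms finite_subset by blast
  have "{keep. \<forall>v\<in>W. \<not> keep v} = Pi V (\<lambda>v. if v \<in> W then {False} else UNIV)"
    using assms(2) by (auto simp: Pi_def split: if_splits)
  then have "measure_pmf.prob (Pi_pmf V False (\<lambda>_. bernoulli_pmf p)) {keep. \<forall>v\<in>W. \<not> keep v}
      = (\<Prod>v\<in>V. measure_pmf.prob (bernoulli_pmf p) (if v \<in> W then {False} else UNIV))"
    using assms(1) by (simp add: measure_Pi_pmf_Pi)
  also have "\<dots> = (\<Prod>v\<in>V. if v \<in> W then 1 - p else 1)"
    using assms by (intro prod.cong) (auto simp: measure_pmf_single)
  also have "\<dots> = (1 - p) ^ card W"
    using assms by (simp add: prod.If_cases Int_absorb1)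
  also have "\<dots> \<le> exp (- p) ^ card W"
    using assms exp_ge_add_one_self[of "- p"] by (intro power_mono) auto
  also have "\<dots> = exp (- p * card W)" by (simp add: exp_of_nat_mult[symmetric] mult.commute)
  finally show ?thesis .
qed

definition sample_space :: "nat \<Rightarrow> (nat \<Rightarrow> 'a::euclidean_space) measure"
  where "sample_space m = (\<Pi>\<^sub>M i\<in>{..<m}. uniform_sphere)"

lemma sample_prob_space: "prob_space (sample_space m :: (nat \<Rightarrow> 'a::euclidean_space) measure)"
  unfolding sample_space_def by (intro prob_space_PiM prob_space_uniform_sphere)

lemma sample_component_measurable [measurable]:
  "i < m \<Longrightarrow> (\<lambda>x. x i) \<in> borel_measurable (sample_space m :: (nat \<Rightarrow> 'a::euclidean_space) measure)"
  unfolding sample_space_def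
  using measurable_component_singleton[of i "{..<m}" "\<lambda>_. uniform_sphere :: 'a measure"]
    measurable_cong_sets[OF refl sets_uniform_sphere] by auto

lemma AE_sample_sphere:
  "AE x in (sample_space m :: (nat \<Rightarrow> 'a::euclidean_space) measure). \<forall>i<m. norm (x i) = 1"
proof -
  interpret product_prob_space "\<lambda>_. uniform_sphere :: 'a measure" "{..<m}"
    by (intro product_prob_spaceI prob_space_uniform_sphere)
  have "AE x in (sample_space m :: (nat \<Rightarrow> 'a) measure). norm (x i) = 1" if "i < m" for i
    unfolding sample_space_def
    using that AE_uniform_sphere by (intro AE_PiM_component) (auto simp: prob_space_uniform_sphere)
  then have "AE x in (sample_space m :: (nat \<Rightarrow> 'a) measure). \<forall>i\<in>{..<m}. norm (x i) = 1"
    by (intro AE_finite_allI) auto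
  then show ?thesis by (simp add: Ball_def)
qed

text \<open>A union bound over \<open>N\<close>; for a single point the event is a box and the draws
  are independent. Measurability is recorded because the integrand of \<open>prob_P2\<close> is
  later bounded below on the complement of this event.\<close>

lemma prob_some_sample_misses_le:
  fixes N :: "'a::euclidean_space set"
  assumes N: "finite N" and c: "\<And>n. n \<in> N \<Longrightarrow> c \<le> measure uniform_sphere (ball n r)"
  shows "{x \<in> space (sample_space m). \<exists>n\<in>N. \<forall>i<m. x i \<notin> ball n r} \<in> sets (sample_space m)" (is ?meas)
    and "measure (sample_space m) {x \<in> space (sample_space m). \<exists>n\<in>N. \<forall>i<m. x i \<notin> ball n r} \<le> card N * exp (- c * m)" (is ?le)
proof -
  interpret S: prob_space "uniform_sphere :: 'a measure" by (rule prob_space_uniform_sphere)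
  interpret product_prob_space "\<lambda>_. uniform_sphere :: 'a measure" "{..<m}"
    by (intro product_prob_spaceI prob_space_uniform_sphere)
  interpret F: finite_product_prob_space "\<lambda>_. uniform_sphere :: 'a measure" "{..<m}"
    by standard auto
  interpret M: prob_space "sample_space m :: (nat \<Rightarrow> 'a) measure" by (rule sample_prob_space)
  define B where "B n = Pi\<^sub>E {..<m} (\<lambda>_. - ball n r)" for n :: 'a
  have B: "B n \<in> sets (sample_space m)" for n
    unfolding B_def sample_space_def by (intro sets_PiM_I_finite) auto
  have eq: "{x \<in> space (sample_space m). \<exists>n\<in>N. \<forall>i<m. x i \<notin> ball n r} = (\<Union>n\<in>N. B n)"
    by (rule set_eqI) (simp add: sample_space_def space_PiM B_def PiE_iff Ball_def, blast)
  have "M.prob (B n) \<le> exp (- c * m)" if "n \<in> N" for n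
  proof -
    have "M.prob (B n) = (\<Prod>i<m. S.prob (- ball n r))"
      unfolding B_def sample_space_def by (subst F.prob_times) auto
    also have "\<dots> = (1 - S.prob (ball n r)) ^ m"
      using S.prob_compl[of "ball n r"] by (simp add: Compl_eq_Diff_UNIV)
    also have "\<dots> \<le> exp (- c) ^ m"
      using exp_ge_add_one_self[of "- c"] c[OF that] by (intro power_mono) auto
    also have "\<dots> = exp (- c * m)" by (simp add: exp_of_nat_mult[symmetric] mult.commute)
    finally show ?thesis .
  qed
  then have "(\<Sum>n\<in>N. M.prob (B n)) \<le> card N * exp (- c * m)" by (rule sum_bounded_above)
  moreover have "M.prob (\<Union>n\<in>N. B n) \<le> (\<Sum>n\<in>N. M.prob (B n))"
    using N B by (intro M.finite_measure_subadditive_finite) auto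
  ultimately show ?le unfolding eq by linarith
  show ?meas unfolding eq using N B by blast
qed

text \<open>The cone over one point lies on a line, a null set in dimension at least 2.\<close>

lemma emeasure_uniform_sphere_singleton:
  fixes a :: "'a::euclidean_space"
  assumes "DIM('a) \<ge> 2"
  shows "emeasure uniform_sphere {a} = 0"
proof -
  have "dim (span {a}) < DIM('a)" using dim_le_card'[of "{a}"] assms by simp
  then have "negligible (span {a})" by (intro negligible_lowdim) simp
  then have neg: "negligible {x \<in> ball 0 1. sgn x \<in> {a}}"
  proof (rule negligible_subset)
    show "{x \<in> ball 0 1. sgn x \<in> {a}} \<subseteq> span {a}"
    proof
      fix x assume x: "x \<in> {x \<in> ball 0 1. sgn x \<in> {a}}"
      have "x = norm x *\<^sub>R sgn x" by (cases "x = 0") (auto simp: sgn_div_norm)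
      then have "x = norm x *\<^sub>R a" using x by simp
      then show "x \<in> span {a}" by (metis insertI1 span_base span_scale)
    qed
  qed
  have "{x \<in> ball 0 1. sgn x \<in> {a}} = ball 0 1 \<inter> sgn -` {a}" by auto
  then have "{x \<in> ball 0 1. sgn x \<in> {a}} \<in> sets borel"
    using measurable_sets[OF borel_measurable_sgn_euclidean, of "{a}"] by simp
  then have "emeasure lborel {x \<in> ball 0 1. sgn x \<in> {a}} = 0"
    using neg by (simp add: negligible_iff_null_sets null_sets_def)
  then show ?thesis by (simp add: emeasure_uniform_sphere)
qed

text \<open>With the other coordinates fixed, coordinate \<open>i\<close> would have to hit the
  single point \<open>x j\<close>. Distinctness gives the sample set exactly \<open>m\<close>
  elements, as the vertex count in the plane requires.\<close>

lemma AE_sample_inj_on: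
  assumes "DIM('a::euclidean_space) \<ge> 2"
  shows "AE x in (sample_space m :: (nat \<Rightarrow> 'a) measure). inj_on x {..<m}"
proof -
  interpret product_prob_space "\<lambda>_. uniform_sphere :: 'a measure" "{..<m}"
    by (intro product_prob_spaceI prob_space_uniform_sphere)
  have "AE x in (sample_space m :: (nat \<Rightarrow> 'a) measure). i \<noteq> j \<longrightarrow> x i \<noteq> x j" if ij: "i < m" "j < m" for i j
  proof (cases "i = j")
    case False
    define E where "E = {x \<in> space (sample_space m :: (nat \<Rightarrow> 'a) measure). x i = x j}"
    have E: "E \<in> sets (sample_space m)" unfolding E_def using ij by measurable
    define J where "J = {..<m} - {i}"
    have I: "{..<m} = insert i J" "i \<notin> J" "finite J" "j \<in> J" using ij False by (auto simp: J_def)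
    have "emeasure (sample_space m) E = (\<integral>\<^sup>+ x. indicator E x \<partial>sample_space m)" using E by simp
    also have "\<dots> = (\<integral>\<^sup>+ x. (\<integral>\<^sup>+ y. indicator E (x(i := y)) \<partial>uniform_sphere) \<partial>(\<Pi>\<^sub>M i\<in>J. (uniform_sphere :: 'a measure)))"
      using E I(2,3) unfolding sample_space_def I(1) by (intro product_nn_integral_insert) auto
    also have "\<dots> \<le> (\<integral>\<^sup>+ x. (\<integral>\<^sup>+ y. indicator {x j} y \<partial>uniform_sphere) \<partial>(\<Pi>\<^sub>M i\<in>J. (uniform_sphere :: 'a measure)))"
      using False by (intro nn_integral_mono) (auto simp: E_def indicator_def)
    also have "\<dots> = 0" using emeasure_uniform_sphere_singleton[OF assms] by simp
    finally have "E \<in> null_sets (sample_space m)" using E by (simp add: null_sets_def)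
    then show ?thesis by (rule AE_I'[OF _]) (auto simp: E_def)
  qed simp
  then have "AE x in (sample_space m :: (nat \<Rightarrow> 'a) measure). \<forall>i\<in>{..<m}. \<forall>j\<in>{..<m}. i \<noteq> j \<longrightarrow> x i \<noteq> x j"
    by (intro AE_finite_allI) auto
  then show ?thesis by (rule eventually_mono) (unfold inj_on_def, blast)
qed

text \<open>At most two tangents to the unit circle pass through \<open>v\<close>. Here
  \<open>T x\<close> is the cross product of \<open>v\<close> and \<open>x\<close>; Lagrange's
  identity fixes its square, so only its sign is free, and \<open>T x\<close> together with
  \<open>x \<bullet> v = 1\<close> determines \<open>x\<close>.\<close>

lemma card_tangents_le_2:
  fixes v :: "'a::euclidean_space"
  assumes "DIM('a) = 2" and X: "\<And>x. x \<in> X \<Longrightarrow> norm x = 1 \<and> x \<bullet> v = 1"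
  shows "finite X \<and> card X \<le> 2"
proof -
  obtain i j :: 'a where ij: "Basis = {i, j}" "i \<noteq> j"
    using assms(1) by (auto simp: card_2_iff)
  define T where "T x = (x \<bullet> j) * (v \<bullet> i) - (x \<bullet> i) * (v \<bullet> j)" for x
  have inner: "x \<bullet> y = (x \<bullet> i) * (y \<bullet> i) + (x \<bullet> j) * (y \<bullet> j)" for x y :: 'a
  proof -
    have "x \<bullet> y = (\<Sum>b\<in>{i, j}. (x \<bullet> b) * (y \<bullet> b))" unfolding ij(1)[symmetric] by (rule euclidean_inner)
    then show ?thesis using ij(2) by simp
  qed
  have T2: "(T x)\<^sup>2 = v \<bullet> v - 1" if "x \<in> X" for x
  proof -
    have "(T x)\<^sup>2 + (x \<bullet> v)\<^sup>2 = (x \<bullet> x) * (v \<bullet> v)"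
      unfolding T_def inner[of x v] inner[of x x] inner[of v v] by (simp add: power2_eq_square algebra_simps)
    then show ?thesis using X[OF that] by (simp add: norm_eq_1)
  qed
  have "inj_on T X"
  proof (rule inj_onI)
    fix x y assume xy: "x \<in> X" "y \<in> X" "T x = T y"
    have "v \<noteq> 0" using X[OF xy(1)] by auto
    have *: "(v \<bullet> v) * (z \<bullet> i) = (v \<bullet> i) * (z \<bullet> v) - (v \<bullet> j) * T z"
            "(v \<bullet> v) * (z \<bullet> j) = (v \<bullet> j) * (z \<bullet> v) + (v \<bullet> i) * T z" for z
      unfolding T_def inner[of z v] inner[of v v] by (simp_all add: algebra_simps)
    have "(v \<bullet> v) * (x \<bullet> i) = (v \<bullet> v) * (y \<bullet> i)" "(v \<bullet> v) * (x \<bullet> j) = (v \<bullet> v) * (y \<bullet> j)"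
      unfolding * using xy X by auto
    then have "x \<bullet> i = y \<bullet> i" "x \<bullet> j = y \<bullet> j" using \<open>v \<noteq> 0\<close> by auto
    then have "\<forall>b\<in>Basis. x \<bullet> b = y \<bullet> b" unfolding ij(1) by blast
    then show "x = y" by (simp only: euclidean_eq_iff[of x y])
  qed
  moreover have sub: "T ` X \<subseteq> {sqrt (v \<bullet> v - 1), - sqrt (v \<bullet> v - 1)}"
  proof
    fix t assume "t \<in> T ` X"
    then have "t\<^sup>2 = v \<bullet> v - 1" using T2 by auto
    then have "\<bar>t\<bar> = sqrt (v \<bullet> v - 1)" by (metis real_sqrt_abs)
    then show "t \<in> {sqrt (v \<bullet> v - 1), - sqrt (v \<bullet> v - 1)}" by (auto simp: abs_if split: if_splits)
  qed
  moreover have "card (T ` X) \<le> 2"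
    using card_mono[OF _ sub] by (simp add: card_insert_if split: if_splits)
  moreover have "finite (T ` X)" using sub by (rule finite_subset) simp
  ultimately show ?thesis by (simp add: card_image finite_image_iff)
qed

section \<open>Vertices of the dual of a covering sample\<close>

lemma prob_random_subpolytope:
  "measure_pmf.prob (random_subpolytope P p) E
    = measure_pmf.prob (Pi_pmf (vertices P) False (\<lambda>_. bernoulli_pmf p)) {keep. convex hull {v \<in> vertices P. keep v} \<in> E}"
  by (simp add: random_subpolytope_def vimage_def)

text \<open>This separates geometry from chance: membership in \<open>E\<close> has to follow
  deterministically once every \<open>W n\<close> retains a vertex, and a union bound handles the
  sets \<open>W n\<close> that lose all of theirs.\<close>

lemma prob_random_subpolytope_ge:
  assumes fin: "finite (vertices P)" and p: "0 \<le> p" "p \<le> 1"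
    and N: "finite N" and W: "\<And>n. n \<in> N \<Longrightarrow> W n \<subseteq> vertices P" "\<And>n. n \<in> N \<Longrightarrow> k \<le> card (W n)"
    and E: "\<And>keep. (\<And>n. n \<in> N \<Longrightarrow> \<exists>v\<in>W n. keep v) \<Longrightarrow> convex hull {v \<in> vertices P. keep v} \<in> E"
  shows "measure_pmf.prob (random_subpolytope P p) E \<ge> 1 - card N * exp (- p * k)"
proof -
  define M where "M = Pi_pmf (vertices P) False (\<lambda>_. bernoulli_pmf p)"
  define B where "B n = {keep. \<forall>v\<in>W n. \<not> keep v}" for n
  have "measure_pmf.prob M (B n) \<le> exp (- p * k)" if "n \<in> N" for n
  proof -
    have "measure_pmf.prob M (B n) \<le> exp (- p * card (W n))"
      unfolding M_def B_def using fin W(1)[OF that] p by (rule prob_none_kept_le)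
    also have "\<dots> \<le> exp (- p * k)" using W(2)[OF that] p by (simp add: mult_left_mono)
    finally show ?thesis .
  qed
  then have "(\<Sum>n\<in>N. measure_pmf.prob M (B n)) \<le> card N * exp (- p * k)" by (rule sum_bounded_above)
  moreover have "measure_pmf.prob M (\<Union>n\<in>N. B n) \<le> (\<Sum>n\<in>N. measure_pmf.prob M (B n))"
    using N by (intro measure_pmf.finite_measure_subadditive_finite) auto
  moreover have "measure_pmf.prob M (- (\<Union>n\<in>N. B n)) = 1 - measure_pmf.prob M (\<Union>n\<in>N. B n)"
    using measure_pmf.prob_compl[of "\<Union>n\<in>N. B n" M] by (simp add: Compl_eq_Diff_UNIV)
  moreover have "measure_pmf.prob M (- (\<Union>n\<in>N. B n)) \<le> measure_pmf.prob M {keep. convex hull {v \<in> vertices P. keep v} \<in> E}"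
  proof (rule measure_pmf.finite_measure_mono)
    show "- (\<Union>n\<in>N. B n) \<subseteq> {keep. convex hull {v \<in> vertices P. keep v} \<in> E}"
    proof
      fix keep assume "keep \<in> - (\<Union>n\<in>N. B n)"
      then have "\<exists>v\<in>W n. keep v" if "n \<in> N" for n using that by (auto simp: B_def)
      then show "keep \<in> {keep. convex hull {v \<in> vertices P. keep v} \<in> E}" using E[of keep] by simp
    qed
  qed simp
  ultimately show ?thesis unfolding prob_random_subpolytope M_def[symmetric] by linarith
qed

text \<open>The deterministic form of a good sample. The factor 2 in the covering radius allows for
  the net: a direction is within \<open>r\<close> of a net point, which is within \<open>r\<close>
  of a sample point.\<close>

locale covering_dual =
  fixes X :: "'a::euclidean_space set" and r :: real
  assumes finite_X: "finite X" and X: "X \<subseteq> sphere 0 1"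
    and cov: "\<And>u. norm u = 1 \<Longrightarrow> \<exists>x\<in>X. dist x u \<le> 2 * r"
    and r: "0 < r" "r \<le> 1 / 2"
begin

abbreviation "P \<equiv> dual (convex hull X)"

lemma norm_le: "y \<in> P \<Longrightarrow> norm y \<le> 1 + 4 * r\<^sup>2"
  using norm_dual_le[OF X cov] r by simp

lemma norm_le_2: "y \<in> P \<Longrightarrow> norm y \<le> 2"
proof -
  assume "y \<in> P"
  moreover have "r\<^sup>2 \<le> 1 / 4" using power_mono[of r "1/2" 2] r by (simp add: power_divide)
  ultimately show ?thesis using norm_le[of y] by linarith
qed

lemma finite_vertices: "finite (vertices P)"
  using finite_X by (rule finite_vertices_dual)

lemma hull_kept_subset: "convex hull {v \<in> vertices P. keep v} \<subseteq> P"
  by (intro hull_minimal convex_dual) (auto simp: vertices_def extreme_point_of_def)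

text \<open>One surviving vertex of \<open>W\<close> makes \<open>Q\<close> nonempty, which suffices
  for a bound of at least 3. The index set \<open>{()}\<close> reduces the union bound to the single
  set \<open>W\<close>.\<close>

lemma prob_hausdorff_le_if_many_vertices:
  assumes p: "0 \<le> p" "p \<le> 1" and W: "W \<subseteq> vertices P" "k \<le> card W" and c: "3 \<le> c"
  shows "measure_pmf.prob (random_subpolytope P p)
      {Q. hausdorff_distance (frontier Q) (sphere 0 1) \<le> ennreal c} \<ge> 1 - exp (- p * k)"
proof -
  have "measure_pmf.prob (random_subpolytope P p)
      {Q. hausdorff_distance (frontier Q) (sphere 0 1) \<le> ennreal c} \<ge> 1 - card {()} * exp (- p * k)"
  proof (rule prob_random_subpolytope_ge[OF finite_vertices p, where W = "\<lambda>_. W"])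
    fix keep assume "\<And>n. n \<in> {()} \<Longrightarrow> \<exists>v\<in>W. keep v"
    then have ne: "convex hull {v \<in> vertices P. keep v} \<noteq> {}" using W(1) by auto
    have "convex hull {v \<in> vertices P. keep v} \<subseteq> cball 0 2"
      using hull_kept_subset[of keep] norm_le_2 by auto
    from hausdorff_distance_frontier_sphere_le_3[OF ne this]
    show "convex hull {v \<in> vertices P. keep v} \<in> {Q. hausdorff_distance (frontier Q) (sphere 0 1) \<le> ennreal c}"
      using ennreal_leI[OF c] by (auto intro: order.trans)
  qed (use W in auto)
  then show ?thesis by simp
qed

text \<open>Spacing \<open>9 * r\<close> along a line orthogonal to \<open>u\<close> exceeds the
  separation \<open>8 * r\<close> asked for by \<open>many_vertices_near\<close>. The resulting
  distance \<open>2 * (9 * (r * K)) + 4 * r\<close> is at most \<open>22 * (r * K)\<close> because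
  \<open>1 \<le> K\<close>.\<close>

lemma vertices_near:
  assumes dim: "DIM('a) \<ge> 2" and u: "norm u = 1" and K: "1 \<le> K" "r * real K \<le> 1 / 40"
  obtains W where "W \<subseteq> vertices P" "card W = K"
    "\<And>v. v \<in> W \<Longrightarrow> 1 \<le> norm v \<and> dist v u \<le> 22 * (r * K)"
proof -
  obtain e0 where e0: "e0 \<noteq> 0" "orthogonal u e0" using orthogonal_to_vector_exists[OF dim] by blast
  define e where "e = sgn e0"
  have e: "norm e = 1" "u \<bullet> e = 0" using e0 by (auto simp: e_def norm_sgn orthogonal_def sgn_div_norm)
  define z where "z j = (9 * r * real j) *\<^sub>R e" for j :: nat
  have dz: "dist (z i) (z j) = 9 * r * \<bar>real i - real j\<bar>" for i j
  proof -
    have "z i - z j = (9 * r * (real i - real j)) *\<^sub>R e" by (simp add: z_def algebra_simps)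
    then show ?thesis using e r by (simp add: dist_norm abs_mult)
  qed
  have dz8: "dist (z i) (z j) > 8 * r" if "i \<noteq> j" for i j
  proof -
    have "\<bar>real i - real j\<bar> \<ge> 1" using that by linarith
    then have "9 * r * \<bar>real i - real j\<bar> \<ge> 9 * r" using r by simp
    then show ?thesis using dz[of i j] r by linarith
  qed
  have "inj z"
  proof (rule injI, rule ccontr)
    fix i j assume "z i = z j" "i \<noteq> j"
    then show False using dz8[of i j] r by simp
  qed
  then have cz: "card (z ` {..<K}) = K" by (simp add: card_image inj_on_subset)
  have "\<exists>W \<subseteq> vertices P. card W = card (z ` {..<K}) \<and>
      (\<forall>v\<in>W. 1 \<le> norm v \<and> dist v u \<le> 2 * (9 * (r * K)) + 4 * r)"
  proof (rule many_vertices_near[OF X norm_le _ _ u, where A = "z ` {..<K}" and b = "9 * (r * K)"])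
    show "u \<bullet> x = 0" if "x \<in> z ` {..<K}" for x using that e by (auto simp: z_def)
    show "norm x \<le> 9 * (r * K)" if "x \<in> z ` {..<K}" for x
      using that e r by (auto simp: z_def)
    show "dist x y > 8 * r" if xy: "x \<in> z ` {..<K}" "y \<in> z ` {..<K}" "x \<noteq> y" for x y
    proof -
      obtain a b where "x = z a" "y = z b" using xy(1,2) by blast
      then show ?thesis using xy(3) dz8[of a b] by auto
    qed
  qed (use r K in auto)
  then obtain W where W: "W \<subseteq> vertices P" "card W = card (z ` {..<K})"
    "\<And>v. v \<in> W \<Longrightarrow> 1 \<le> norm v \<and> dist v u \<le> 2 * (9 * (r * K)) + 4 * r"
    by auto
  have "4 * r \<le> 4 * (r * K)" using K r by simp
  then have "1 \<le> norm v \<and> dist v u \<le> 22 * (r * K)" if "v \<in> W" for v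
    using W(3)[OF that] by linarith
  then show thesis using that[of W] W(1,2) cz by simp
qed

text \<open>The net has the scale \<open>r * K\<close> of the caps holding \<open>K\<close> vertices
  each. A kept vertex in every such cap bounds the support function of \<open>Q\<close> from below
  in all directions, hence puts a ball into \<open>Q\<close>.\<close>

lemma prob_hausdorff_le:
  assumes dim: "DIM('a) \<ge> 2" and p: "0 \<le> p" "p \<le> 1" and K: "1 \<le> K" "r * real K \<le> 1 / 40"
    and c: "300 * (r * K)\<^sup>2 \<le> c"
  shows "measure_pmf.prob (random_subpolytope P p)
      {Q. hausdorff_distance (frontier Q) (sphere 0 1) \<le> ennreal c}
    \<ge> 1 - 16 ^ DIM('a) / (r * K) ^ (DIM('a) - 1) * exp (- p * K)"
proof -
  define s where "s = r * K"
  have s: "0 < s" "s \<le> 1 / 40" "r \<le> s" using K r by (auto simp: s_def)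
  obtain N :: "'a set" where N: "finite N" "N \<subseteq> sphere 0 1"
    "\<And>u. norm u = 1 \<Longrightarrow> \<exists>n\<in>N. dist u n < s" "real (card N) \<le> 16 ^ DIM('a) / s ^ (DIM('a) - 1)"
    using sphere_net[of s] s by auto
  have "\<exists>W. W \<subseteq> vertices P \<and> card W = K \<and> (\<forall>v\<in>W. 1 \<le> norm v \<and> dist v n \<le> 22 * s)" if "n \<in> N" for n
    using vertices_near[OF dim, of n K] that N(2) K unfolding s_def by (metis mem_sphere_0 subsetD)
  then obtain W where W: "\<And>n. n \<in> N \<Longrightarrow> W n \<subseteq> vertices P \<and> card (W n) = K \<and>
      (\<forall>v\<in>W n. 1 \<le> norm v \<and> dist v n \<le> 22 * s)"
    by metis
  have s2: "300 * s\<^sup>2 < 1" using power_mono[of s "1/40" 2] s by (simp add: power_divide)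
  have "measure_pmf.prob (random_subpolytope P p)
      {Q. hausdorff_distance (frontier Q) (sphere 0 1) \<le> ennreal c} \<ge> 1 - card N * exp (- p * K)"
  proof (rule prob_random_subpolytope_ge[OF finite_vertices p N(1), where W = W])
    fix keep assume keep: "\<And>n. n \<in> N \<Longrightarrow> \<exists>v\<in>W n. keep v"
    define Q where "Q = convex hull {v \<in> vertices P. keep v}"
    have "cball 0 (1 - 300 * s\<^sup>2) \<subseteq> Q"
    proof (rule cball_subset_if_support_ge)
      show "convex Q" by (simp add: Q_def)
      have "compact Q" unfolding Q_def using finite_vertices by (intro finite_imp_compact_convex_hull) simp
      then show "closed Q" by (rule compact_imp_closed)
      fix u :: 'a assume u: "norm u = 1"
      obtain n where n: "n \<in> N" "dist u n < s" using N(3)[OF u] by blast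
      then obtain v where v: "v \<in> W n" "keep v" using keep by blast
      then have v': "1 \<le> norm v" "dist v n \<le> 22 * s" "v \<in> vertices P" using W[OF n(1)] by auto
      \<comment> \<open>The 23 is 22 for the cap plus 1 for the net. As \<open>norm v\<close> is at
        least 1, the inner product falls short of 1 by at most
        \<open>23\<^sup>2 / 2 * s\<^sup>2\<close>, rounded up to
        \<open>300 * s\<^sup>2\<close>.\<close>
      have "dist v u \<le> 23 * s" using n v' dist_triangle2[of v u n] by linarith
      then have "(dist v u)\<^sup>2 \<le> (23 * s)\<^sup>2" by (intro power_mono) auto
      moreover have "(dist v u)\<^sup>2 = (norm v)\<^sup>2 + 1 - 2 * (v \<bullet> u)"
        using u by (simp add: dist_norm power2_norm_eq_inner inner_diff_left inner_diff_right
            inner_commute norm_eq_1)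
      moreover have "(norm v)\<^sup>2 \<ge> 1" using v'(1) by (simp add: one_le_power)
      ultimately have "v \<bullet> u \<ge> 1 - 529 / 2 * s\<^sup>2" by (simp add: power_mult_distrib)
      moreover have "529 / 2 * s\<^sup>2 \<le> 300 * s\<^sup>2" by simp
      ultimately have "v \<bullet> u \<ge> 1 - 300 * s\<^sup>2" by linarith
      moreover have "v \<in> Q" unfolding Q_def using v(2) v'(3) by (intro hull_inc) simp
      ultimately show "\<exists>v\<in>Q. v \<bullet> u \<ge> 1 - 300 * s\<^sup>2" by blast
    qed
    moreover have "Q \<subseteq> cball 0 (1 + 300 * s\<^sup>2)"
    proof
      fix y assume "y \<in> Q"
      then have "norm y \<le> 1 + 4 * r\<^sup>2" using hull_kept_subset norm_le unfolding Q_def by blast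
      moreover have "r\<^sup>2 \<le> s\<^sup>2" using s r by (intro power_mono) auto
      moreover have "4 * s\<^sup>2 \<le> 300 * s\<^sup>2" by simp
      ultimately show "y \<in> cball 0 (1 + 300 * s\<^sup>2)" unfolding mem_cball_0 by linarith
    qed
    ultimately have "hausdorff_distance (frontier Q) (sphere 0 1) \<le> ennreal (300 * s\<^sup>2)"
      using s2 by (intro hausdorff_distance_frontier_sphere_le) auto
    also have "\<dots> \<le> ennreal c" using c unfolding s_def by (rule ennreal_leI)
    finally show "convex hull {v \<in> vertices P. keep v} \<in> {Q. hausdorff_distance (frontier Q) (sphere 0 1) \<le> ennreal c}"
      unfolding Q_def by simp
  qed (use W in auto)
  moreover have "card N * exp (- p * K) \<le> 16 ^ DIM('a) / s ^ (DIM('a) - 1) * exp (- p * K)"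
    using N(4) by (intro mult_right_mono) auto
  ultimately show ?thesis unfolding s_def by linarith
qed

text \<open>Each \<open>x\<close> in \<open>X\<close> lies in its own dual constraint with equality,
  so a vertex maximising the inner product with \<open>x\<close> is on the tangent at
  \<open>x\<close>. By \<open>card_tangents_le_2\<close> a vertex serves at most two such
  \<open>x\<close>.\<close>

lemma card_vertices_ge_dim_2:
  assumes dim: "DIM('a) = 2"
  shows "card X \<le> 2 * card (vertices P)"
proof -
  have "\<exists>v. v \<in> vertices P \<and> x \<bullet> v = 1" if x: "x \<in> X" for x
  proof -
    have nx: "norm x = 1" using x X by auto
    have "y \<bullet> x \<le> 1" if "y \<in> X" for y
      using that X nx norm_cauchy_schwarz[of y x] by auto
    then have "x \<in> P" by (simp add: dual_convex_hull)
    then obtain v where v: "v \<in> vertices P" "x \<bullet> x \<le> x \<bullet> v"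
      using vertex_maximizing[OF compact_dual[OF norm_le] convex_dual] by blast
    have "v \<in> P" using v(1) by (auto simp: vertices_def extreme_point_of_def)
    then have "x \<bullet> v \<le> 1" using x by (auto simp: dual_convex_hull)
    then show ?thesis using v nx by (force simp: norm_eq_1)
  qed
  then obtain f where f: "\<And>x. x \<in> X \<Longrightarrow> f x \<in> vertices P \<and> x \<bullet> f x = 1" by metis
  have "X \<subseteq> (\<Union>v\<in>vertices P. {x \<in> X. x \<bullet> v = 1})" using f by blast
  then have "card X \<le> card (\<Union>v\<in>vertices P. {x \<in> X. x \<bullet> v = 1})"
    using finite_X finite_vertices by (intro card_mono) auto
  also have "\<dots> \<le> (\<Sum>v\<in>vertices P. card {x \<in> X. x \<bullet> v = 1})"
    using finite_vertices by (rule card_UN_le)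
  also have "\<dots> \<le> (\<Sum>v\<in>vertices P. 2)"
  proof (rule sum_mono)
    fix v
    have "finite {x \<in> X. x \<bullet> v = 1} \<and> card {x \<in> X. x \<bullet> v = 1} \<le> 2"
      using X by (intro card_tangents_le_2[OF dim, of _ v]) auto
    then show "card {x \<in> X. x \<bullet> v = 1} \<le> 2" by blast
  qed
  finally show ?thesis by (simp add: mult.commute)
qed

text \<open>A square grid in a plane orthogonal to \<open>u\<close> yields of order
  \<open>1 / r\<^sup>2\<close> vertices. A single great circle yields only order
  \<open>1 / r\<close>, and the logarithm in the later choice of \<open>r\<close> could keep
  \<open>p / r\<close> from tending to infinity.\<close>

lemma many_vertices_dim_ge_3:
  assumes dim: "DIM('a) \<ge> 3" and K: "18 * r * real K \<le> 1"
  obtains W where "W \<subseteq> vertices P" "card W = K\<^sup>2"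
proof -
  obtain T :: "'a set" where T: "T \<subseteq> Basis" "card T = 3"
    using obtain_subset_with_card_n[OF dim] by blast
  then obtain u e f where uef: "T = {u, e, f}" "u \<noteq> e" "u \<noteq> f" "e \<noteq> f"
    by (auto simp: card_3_iff)
  have B: "u \<in> Basis" "e \<in> Basis" "f \<in> Basis" using T uef by auto
  have o: "u \<bullet> e = 0" "u \<bullet> f = 0" "e \<bullet> f = 0" "f \<bullet> e = 0" "e \<bullet> e = 1" "f \<bullet> f = 1"
    using B uef by (simp_all add: inner_Basis)
  define z where "z = (\<lambda>(j::nat, k::nat). (9 * r) *\<^sub>R (real j *\<^sub>R e + real k *\<^sub>R f))"
  have dz8: "dist (z a) (z b) > 8 * r" if "a \<noteq> b" for a b
  proof -
    obtain j k j' k' where ab: "a = (j, k)" "b = (j', k')" by (cases a, cases b) auto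
    define D where "D = z a - z b"
    have De: "D \<bullet> e = 9 * r * (real j - real j')" and Df: "D \<bullet> f = 9 * r * (real k - real k')"
      using o by (simp_all add: D_def z_def ab inner_diff_left inner_add_left algebra_simps)
    have "\<bar>real j - real j'\<bar> \<ge> 1 \<or> \<bar>real k - real k'\<bar> \<ge> 1" using that ab by auto
    then have "9 * r \<le> \<bar>D \<bullet> e\<bar> \<or> 9 * r \<le> \<bar>D \<bullet> f\<bar>" unfolding De Df using r by (simp add: abs_mult)
    then have "9 * r \<le> norm D" using Basis_le_norm[OF B(2), of D] Basis_le_norm[OF B(3), of D] by linarith
    then show ?thesis using r by (simp add: D_def dist_norm)
  qed
  have inj: "inj z"
  proof (rule injI, rule ccontr)
    fix a b assume "z a = z b" "a \<noteq> b"
    then show False using dz8[of a b] r by simp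
  qed
  define A where "A = z ` ({..<K} \<times> {..<K})"
  have "card A = K\<^sup>2" unfolding A_def using inj
    by (simp add: card_image inj_on_subset card_cartesian_product power2_eq_square)
  moreover have "\<exists>W \<subseteq> vertices P. card W = card A \<and> (\<forall>v\<in>W. 1 \<le> norm v \<and> dist v u \<le> 2 * 1 + 4 * r)"
  proof (rule many_vertices_near[OF X norm_le, where A = A and b = 1 and u = u])
    show "u \<bullet> x = 0" if "x \<in> A" for x
      using that o by (auto simp: A_def z_def inner_add_right)
    show "norm x \<le> 1" if "x \<in> A" for x
    proof -
      obtain j k where jk: "j < K" "k < K" "x = z (j, k)" using \<open>x \<in> A\<close> by (auto simp: A_def)
      have "norm (real j *\<^sub>R e + real k *\<^sub>R f) \<le> real j + real k"
        using norm_triangle_ineq[of "real j *\<^sub>R e" "real k *\<^sub>R f"] B by simp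
      also have "\<dots> \<le> 2 * real K" using jk by simp
      finally have "norm x \<le> 9 * r * (2 * real K)" using r jk by (simp add: z_def)
      then show ?thesis using K by simp
    qed
    show "dist x y > 8 * r" if xy: "x \<in> A" "y \<in> A" "x \<noteq> y" for x y
    proof -
      obtain a b where "x = z a" "y = z b" using xy(1,2) unfolding A_def by blast
      then show ?thesis using xy(3) dz8[of a b] by auto
    qed
  qed (use r B in auto)
  ultimately show thesis using that by auto
qed

end

text \<open>Off the measurable event \<open>B\<close> the sample almost surely consists of
  \<open>m\<close> distinct unit vectors and covers the sphere, so the conditional probability is at
  least \<open>1 - \<epsilon>\<close>. Comparing with a multiple of the indicator of
  \<open>G\<close> asks for no measurability of the integrand.\<close>

lemma prob_P2_ge:
  fixes E :: "'a::euclidean_space set set"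
  assumes dim: "DIM('a) \<ge> 2" and r: "0 < r" "r \<le> 1 / 2" and \<epsilon>: "\<epsilon> \<le> 1"
    and E: "\<And>X :: 'a set. covering_dual X r \<Longrightarrow> card X = m \<Longrightarrow>
      measure_pmf.prob (random_subpolytope (dual (convex hull X)) p) E \<ge> 1 - \<epsilon>"
  shows "ennreal ((1 - \<epsilon>) * (1 - 16 ^ DIM('a) / r ^ (DIM('a) - 1) * exp (- (r ^ (DIM('a) - 1) / 8 ^ DIM('a)) * m)))
    \<le> prob_P2 m p E"
proof -
  interpret M: prob_space "sample_space m :: (nat \<Rightarrow> 'a) measure" by (rule sample_prob_space)
  define c where "c = r ^ (DIM('a) - 1) / 8 ^ DIM('a)"
  obtain N :: "'a set" where N: "finite N" "N \<subseteq> sphere 0 1"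
    "\<And>u. norm u = 1 \<Longrightarrow> \<exists>n\<in>N. dist u n < r" "real (card N) \<le> 16 ^ DIM('a) / r ^ (DIM('a) - 1)"
    using sphere_net[of r] r by auto
  define B where "B = {x \<in> space (sample_space m). \<exists>n\<in>N. \<forall>i<m. x i \<notin> ball n r}"
  have c: "c \<le> measure uniform_sphere (ball n r)" if "n \<in> N" for n
    unfolding c_def using that N(2) r by (intro measure_uniform_sphere_ball_ge) auto
  have B: "B \<in> sets (sample_space m)" unfolding B_def by (rule prob_some_sample_misses_le(1)[OF N(1) c])
  have "M.prob B \<le> card N * exp (- c * m)" unfolding B_def by (rule prob_some_sample_misses_le(2)[OF N(1) c])
  also have "\<dots> \<le> 16 ^ DIM('a) / r ^ (DIM('a) - 1) * exp (- c * m)" using N(4) by (intro mult_right_mono) auto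
  finally have pB: "M.prob B \<le> 16 ^ DIM('a) / r ^ (DIM('a) - 1) * exp (- c * m)" .
  define G where "G = space (sample_space m) - B"
  have G: "G \<in> sets (sample_space m)" unfolding G_def using B by blast
  have pG: "M.prob G = 1 - M.prob B" unfolding G_def using B by (rule M.prob_compl)
  have "ennreal ((1 - \<epsilon>) * (1 - 16 ^ DIM('a) / r ^ (DIM('a) - 1) * exp (- c * m)))
      \<le> ennreal ((1 - \<epsilon>) * M.prob G)"
    using pB pG \<epsilon> by (intro ennreal_leI mult_left_mono) auto
  also have "\<dots> = ennreal (1 - \<epsilon>) * emeasure (sample_space m) G"
    using \<epsilon> by (simp add: ennreal_mult M.emeasure_eq_measure)
  also have "\<dots> = (\<integral>\<^sup>+ x. ennreal (1 - \<epsilon>) * indicator G x \<partial>sample_space m)"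
    using G by (simp add: nn_integral_cmult_indicator)
  also have "\<dots> \<le> (\<integral>\<^sup>+ x. emeasure (measure_pmf (random_subpolytope (dual (convex hull (x ` {..<m}))) p)) E
        \<partial>sample_space m)"
  proof (rule nn_integral_mono_AE)
    show "AE x in sample_space m. ennreal (1 - \<epsilon>) * indicator G x
       \<le> emeasure (measure_pmf (random_subpolytope (dual (convex hull (x ` {..<m}))) p)) E"
      using AE_sample_sphere AE_sample_inj_on[OF dim]
    proof eventually_elim
      fix x :: "nat \<Rightarrow> 'a" assume x: "\<forall>i<m. norm (x i) = 1" "inj_on x {..<m}"
      show "ennreal (1 - \<epsilon>) * indicator G x
         \<le> emeasure (measure_pmf (random_subpolytope (dual (convex hull (x ` {..<m}))) p)) E"
      proof (cases "x \<in> G")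
        case True
        have "covering_dual (x ` {..<m}) r"
        proof
          fix u :: 'a assume "norm u = 1"
          then obtain n where n: "n \<in> N" "dist u n < r" using N(3) by blast
          have "\<exists>i<m. x i \<in> ball n r" using True n(1) unfolding G_def B_def by blast
          then obtain i where i: "i < m" "dist n (x i) < r" by auto
          have "dist (x i) u \<le> 2 * r" using n i dist_triangle[of "x i" u n] by (simp add: dist_commute)
          then show "\<exists>y\<in>x ` {..<m}. dist y u \<le> 2 * r" using i by blast
        qed (use x r in auto)
        moreover have "card (x ` {..<m}) = m" using x by (simp add: card_image)
        ultimately have "measure_pmf.prob (random_subpolytope (dual (convex hull (x ` {..<m}))) p) E \<ge> 1 - \<epsilon>"
          by (rule E)
        then show ?thesis using True by (simp add: measure_pmf.emeasure_eq_measure ennreal_leI)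
      qed simp
    qed
  qed
  finally show ?thesis unfolding prob_P2_def sample_space_def c_def .
qed

lemma prob_P2_le_1: "prob_P2 m p E \<le> 1"
proof -
  interpret M: prob_space "sample_space m :: (nat \<Rightarrow> 'a) measure" by (rule sample_prob_space)
  have "prob_P2 m p E \<le> (\<integral>\<^sup>+ x. 1 \<partial>(sample_space m :: (nat \<Rightarrow> 'a) measure))"
    unfolding prob_P2_def sample_space_def by (intro nn_integral_mono measure_pmf.emeasure_le_1)
  then show ?thesis by (simp add: M.emeasure_space_1)
qed

section \<open>Asymptotics\<close>

text \<open>A bound for a single \<open>m\<close>. The summands of \<open>\<epsilon>\<close> belong
  to two regimes: the first bounds the failure probability when \<open>r * K\<close> is small, the
  second that of keeping no vertex at all otherwise.\<close>

lemma prob_P2_hausdorff_ge: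
  fixes p b :: real and m :: nat
  defines "D \<equiv> DIM('a::euclidean_space)"
  defines "\<alpha> \<equiv> 1 / (real D - 1)" and "R \<equiv> (64::real) ^ D"
  defines "L \<equiv> (ln m / m) powr \<alpha>"
  defines "\<epsilon> \<equiv> 16 ^ D / (p * m) + exp (- (p * m powr \<alpha>) / (1296 * R\<^sup>2))"
  assumes dim: "D \<ge> 2" and p: "0 < p" "p \<le> 1"
    and ln: "ln m \<ge> 1" "ln (p * m) \<ge> 1" "(ln m)\<^sup>2 \<le> m"
    and small: "R * L \<le> 1 / 36" "\<epsilon> \<le> 1"
    and b: "4800 * (2 * real D * R * (ln (p * m) * L / p))\<^sup>2 \<le> b"
  shows "ennreal ((1 - \<epsilon>) * (1 - 16 ^ D / m))
    \<le> prob_P2 m p {Q :: 'a set. hausdorff_distance (frontier Q) (sphere 0 1) \<le> ennreal b}"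
proof -
  define r where "r = R * L"
  \<comment> \<open>With this \<open>K\<close>, \<open>exp (- p * K)\<close> is at most
    \<open>1 / (p * m) ^ D\<close>, which beats the net size of order
    \<open>(p * m) ^ (D - 1)\<close> by a factor \<open>p * m\<close>.\<close>
  define K where "K = nat \<lceil>D * ln (p * m) / p\<rceil>"
  \<comment> \<open>Since \<open>ln 0 = 0\<close>, the assumption \<open>ln m \<ge> 1\<close>
    excludes \<open>m = 0\<close>.\<close>
  have m: "real m > 0"
  proof (rule ccontr)
    assume "\<not> real m > 0"
    then have "m = 0" by simp
    then show False using ln(1) by simp
  qed
  have R1: "R \<ge> 1" by (simp add: R_def)
  have \<alpha>: "0 < \<alpha>" "\<alpha> \<le> 1" "\<alpha> * real (D - 1) = 1" using dim by (auto simp: \<alpha>_def of_nat_diff)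
  have lm: "0 < ln m / m" using ln m by (intro divide_pos_pos) linarith+
  then have L0: "L > 0" using m by (auto simp: L_def)
  have r: "0 < r" "r \<le> 1 / 2" and r36: "r \<le> 1 / 36" using small R1 L0 by (auto simp: r_def)
  have LD: "L ^ (D - 1) = ln m / m"
  proof -
    have "L ^ (D - 1) = L powr real (D - 1)" using L0 by (simp add: powr_realpow)
    also have "\<dots> = ln m / m" unfolding L_def powr_powr \<alpha>(3) using ln m by simp
    finally show ?thesis .
  qed
  have L_ge: "L \<ge> 1 / m powr \<alpha>"
  proof -
    have "1 / m powr \<alpha> = (1 / m) powr \<alpha>" using m by (simp add: powr_divide)
    also have "\<dots> \<le> L" unfolding L_def using ln m \<alpha> by (intro powr_mono2) (auto simp: divide_right_mono)
    finally show ?thesis .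
  qed
  have pm: "p * m > 0" using p m by simp
  have m1: "real m \<ge> 1" using m by simp
  have L_ge': "L \<ge> 1 / m"
  proof -
    have "m powr \<alpha> \<le> m powr 1" using m1 \<alpha> by (intro powr_mono) auto
    then have "1 / m \<le> 1 / m powr \<alpha>" using m by (intro divide_left_mono) auto
    then show ?thesis using L_ge by linarith
  qed
  have K_ge: "D * ln (p * m) / p \<le> K" unfolding K_def by linarith
  have "D * ln (p * m) / p \<ge> 1"
  proof -
    have "D * ln (p * m) \<ge> 1 * 1" using dim ln by (intro mult_mono) auto
    then show ?thesis using p by (simp add: field_simps)
  qed
  moreover have "1 \<le> nat \<lceil>q\<rceil> \<and> nat \<lceil>q\<rceil> \<le> 2 * q" if "q \<ge> 1" for q :: real using that by linarith
  ultimately have K: "1 \<le> K" "K \<le> 2 * (D * ln (p * m) / p)" unfolding K_def by blast+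
  define t where "t = ln (p * m) * L / p"
  have s_le: "r * K \<le> 2 * real D * R * t"
  proof -
    have "r * K \<le> r * (2 * (D * ln (p * m) / p))" using K(2) r by (intro mult_left_mono) auto
    also have "\<dots> = 2 * real D * R * t" by (simp add: r_def t_def)
    finally show ?thesis .
  qed
  have s_ge: "r * K \<ge> 1 / (p * m)"
  proof -
    have "1 / (p * m) = (1 * 1 * (1 / m)) * (1 * 1) / p" using p by simp
    also have "\<dots> \<le> (R * L) * (D * ln (p * m)) / p"
      using L_ge' L0 R1 dim ln p m by (intro divide_right_mono mult_mono) (auto intro!: mult_nonneg_nonneg)
    also have "\<dots> = r * (D * ln (p * m) / p)" by (simp add: r_def)
    also have "\<dots> \<le> r * K" using K_ge r by (intro mult_left_mono) auto
    finally show ?thesis .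
  qed
  have b_ge: "4800 * (r * K)\<^sup>2 \<le> b"
  proof -
    have "(r * K)\<^sup>2 \<le> (2 * real D * R * t)\<^sup>2" using s_le r by (intro power_mono) auto
    then show ?thesis using b unfolding t_def by linarith
  qed
  have \<epsilon>1: "16 ^ D / (r * K) ^ (D - 1) * exp (- p * K) \<le> \<epsilon>"
  proof -
    have "D * ln (p * m) \<le> p * K" using K_ge p by (simp add: field_simps)
    then have "exp (- p * K) \<le> exp (- (D * ln (p * m)))" by simp
    also have "\<dots> = 1 / (p * m) ^ D" using pm by (simp add: exp_minus exp_of_nat_mult inverse_eq_divide)
    finally have 1: "exp (- p * K) \<le> 1 / (p * m) ^ D" .
    have "(1 / (p * m)) ^ (D - 1) \<le> (r * K) ^ (D - 1)" using s_ge pm by (intro power_mono) auto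
    then have "16 ^ D / (r * K) ^ (D - 1) \<le> 16 ^ D / (1 / (p * m)) ^ (D - 1)"
      using pm r K by (intro divide_left_mono) auto
    also have "\<dots> = 16 ^ D * (p * m) ^ (D - 1)" by (simp add: power_divide)
    finally have "16 ^ D / (r * K) ^ (D - 1) * exp (- p * K) \<le> 16 ^ D * (p * m) ^ (D - 1) * (1 / (p * m) ^ D)"
      using 1 pm by (intro mult_mono) auto
    also have "(p * m) ^ D = (p * m) ^ (D - 1) * (p * m)" using dim power_minus_mult[of D "p * m"] by simp
    then have "16 ^ D * (p * m) ^ (D - 1) * (1 / (p * m) ^ D) = 16 ^ D / (p * m)" using pm by simp
    also have "\<dots> \<le> \<epsilon>" by (simp add: \<epsilon>_def)
    finally show ?thesis .
  qed
  have \<epsilon>2: "exp (- p * k) \<le> \<epsilon>" if "m powr \<alpha> / (1296 * R\<^sup>2) \<le> k" for k :: real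
  proof -
    have "p * (m powr \<alpha> / (1296 * R\<^sup>2)) \<le> p * k" using that p by (intro mult_left_mono) auto
    then have "exp (- p * k) \<le> exp (- (p * m powr \<alpha>) / (1296 * R\<^sup>2))" by simp
    also have "\<dots> \<le> \<epsilon>" using pm by (simp add: \<epsilon>_def)
    finally show ?thesis .
  qed
  \<comment> \<open>\<open>R = 8 ^ D * 8 ^ D\<close> leaves a factor of at least 2 after division by
    \<open>8 ^ D\<close>, so the exponential is at most \<open>1 / m\<^sup>2\<close>, against a net
    size bound of at most \<open>16 ^ D * m\<close>.\<close>
  have \<delta>: "16 ^ D / r ^ (D - 1) * exp (- (r ^ (D - 1) / 8 ^ D) * m) \<le> 16 ^ D / m"
  proof -
    have rD: "r ^ (D - 1) = R ^ (D - 1) * (ln m / m)" unfolding r_def power_mult_distrib LD ..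
    have R_ge: "R ^ (D - 1) \<ge> R" using dim R1 power_increasing[of 1 "D - 1" R] by simp
    have "1 / m \<le> r ^ (D - 1)"
    proof -
      have "1 * (1 / m) \<le> R ^ (D - 1) * (ln m / m)"
        using R1 R_ge ln m by (intro mult_mono) (auto simp: divide_right_mono)
      then show ?thesis unfolding rD by simp
    qed
    then have 1: "16 ^ D / r ^ (D - 1) \<le> 16 ^ D / (1 / m)" using r m by (intro divide_left_mono) auto
    have "2 * 8 ^ D \<le> R"
    proof -
      have "(2::real) \<le> 8 ^ D" using power_increasing[of 1 D "8::real"] dim by simp
      then have "2 * (8::real) ^ D \<le> 8 ^ D * 8 ^ D" by (intro mult_right_mono) auto
      also have "\<dots> = R" unfolding R_def power_mult_distrib[symmetric] by simp
      finally show ?thesis .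
    qed
    then have "2 * 8 ^ D \<le> R ^ (D - 1)" using R_ge by linarith
    then have "2 * ln m \<le> R ^ (D - 1) / 8 ^ D * ln m" using ln by (intro mult_right_mono) (auto simp: field_simps)
    also have "\<dots> = r ^ (D - 1) / 8 ^ D * m" unfolding rD using m by simp
    finally have "exp (- (r ^ (D - 1) / 8 ^ D) * m) \<le> exp (- (2 * ln m))" by simp
    also have "\<dots> = 1 / m ^ 2"
      using m exp_of_nat_mult[of 2 "ln (real m)"] by (simp add: exp_minus inverse_eq_divide)
    finally have "16 ^ D / r ^ (D - 1) * exp (- (r ^ (D - 1) / 8 ^ D) * m) \<le> 16 ^ D / (1 / m) * (1 / m ^ 2)"
      using 1 m by (intro mult_mono) auto
    also have "\<dots> = 16 ^ D / m" using m by (simp add: power2_eq_square)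
    finally show ?thesis .
  qed
  have cond: "measure_pmf.prob (random_subpolytope (dual (convex hull X)) p)
      {Q. hausdorff_distance (frontier Q) (sphere 0 1) \<le> ennreal b} \<ge> 1 - \<epsilon>"
    if cd: "covering_dual X r" and card: "card X = m" for X :: "'a set"
  proof -
    interpret covering_dual X r by (rule cd)
    show ?thesis
    proof (cases "r * K \<le> 1 / 40")
      case True
      have "300 * (r * K)\<^sup>2 \<le> b" using b_ge by (smt (verit) zero_le_power2)
      from prob_hausdorff_le[OF _ _ p(2) K(1) True this] show ?thesis
        using \<epsilon>1 dim p unfolding D_def by force
    next
      case False
      \<comment> \<open>Since \<open>4800 = 3 * 40\<^sup>2\<close>, a scale \<open>r * K\<close>
        above 1/40 forces \<open>3 \<le> b\<close>.\<close>
      then have "(1 / 40)\<^sup>2 \<le> (r * K)\<^sup>2" by (intro power_mono) auto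
      then have b3: "3 \<le> b" using b_ge by (simp add: power_divide)
      have "\<exists>W \<subseteq> vertices P. m powr \<alpha> / (1296 * R\<^sup>2) \<le> card W"
      proof (cases "D = 2")
        case True
        have "1 \<le> R\<^sup>2" using R1 by simp
        then have "m powr \<alpha> / (1296 * R\<^sup>2) \<le> m / 2"
          using True m by (intro frac_le) (auto simp: \<alpha>_def)
        also have "\<dots> \<le> card (vertices P)"
          using card_vertices_ge_dim_2 True card unfolding D_def by simp
        finally show ?thesis by blast
      next
        case False
        \<comment> \<open>The largest grid that fits. As \<open>r \<le> 1 / 36\<close>, rounding
          down at most halves \<open>1 / (18 * r)\<close>, so \<open>k\<^sup>2\<close> is at least
          \<open>(1 / (36 * r))\<^sup>2\<close>; this explains
          \<open>1296 = 36\<^sup>2\<close>.\<close>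
        define k where "k = nat \<lfloor>1 / (18 * r)\<rfloor>"
        have floor: "nat \<lfloor>q\<rfloor> \<le> q \<and> q / 2 \<le> nat \<lfloor>q\<rfloor>" if "q \<ge> 2" for q :: real using that by linarith
        have "1 / (18 * r) \<ge> 2" using r36 r by (simp add: field_simps)
        from floor[OF this] have k: "k \<le> 1 / (18 * r)" "1 / (36 * r) \<le> k"
          unfolding k_def by simp_all
        have "DIM('a) \<ge> 3" using False dim by (simp add: D_def)
        moreover have "18 * r * k \<le> 1" using k(1) r by (simp add: field_simps)
        ultimately obtain W where W: "W \<subseteq> vertices P" "card W = k\<^sup>2"
          by (rule many_vertices_dim_ge_3)
        \<comment> \<open>The left side is \<open>((ln m)\<^sup>2 / m) powr \<alpha>\<close>, so the
          hypothesis \<open>(ln m)\<^sup>2 \<le> m\<close> absorbs the logarithms.\<close>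
        have "m powr \<alpha> * L\<^sup>2 \<le> 1"
        proof -
          have "L\<^sup>2 = ((ln m / m)\<^sup>2) powr \<alpha>"
            unfolding L_def power2_eq_square by (rule powr_mult[symmetric])
          then have "m powr \<alpha> * L\<^sup>2 = (m * (ln m / m)\<^sup>2) powr \<alpha>" using m by (simp add: powr_mult)
          also have "m * (ln m / m)\<^sup>2 = (ln m)\<^sup>2 / m" using m by (simp add: power2_eq_square)
          also have "((ln m)\<^sup>2 / m) powr \<alpha> \<le> 1 powr \<alpha>"
            using ln m \<alpha> by (intro powr_mono2) auto
          finally show ?thesis by simp
        qed
        then have "m powr \<alpha> / (1296 * R\<^sup>2) \<le> (1 / (36 * r))\<^sup>2"
          using L0 R1 by (simp add: r_def power_mult_distrib power_divide field_simps)
        also have "\<dots> \<le> (real k)\<^sup>2" using k(2) r by (intro power_mono) auto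
        finally show ?thesis using W by (intro exI[of _ W]) simp
      qed
      then obtain W where W: "W \<subseteq> vertices P" "m powr \<alpha> / (1296 * R\<^sup>2) \<le> card W" by blast
      from prob_hausdorff_le_if_many_vertices[OF _ p(2) W(1) order_refl b3] \<epsilon>2[OF W(2)] p
      show ?thesis by force
    qed
  qed
  have "(1 - \<epsilon>) * (1 - 16 ^ D / m)
      \<le> (1 - \<epsilon>) * (1 - 16 ^ D / r ^ (D - 1) * exp (- (r ^ (D - 1) / 8 ^ D) * m))"
    using \<delta> small by (intro mult_left_mono) auto
  then have "ennreal ((1 - \<epsilon>) * (1 - 16 ^ D / m))
      \<le> ennreal ((1 - \<epsilon>) * (1 - 16 ^ D / r ^ (D - 1) * exp (- (r ^ (D - 1) / 8 ^ D) * m)))"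
    by (rule ennreal_leI)
  also have "\<dots> \<le> prob_P2 m p {Q :: 'a set. hausdorff_distance (frontier Q) (sphere 0 1) \<le> ennreal b}"
    unfolding D_def by (rule prob_P2_ge) (use dim r small cond in \<open>auto simp: D_def\<close>)
  finally show ?thesis .
qed

theorem theorem4:
  assumes "CARD('d::finite) \<ge> 2"
  shows "\<exists>C>0. \<forall>p::nat \<Rightarrow> real.
    (\<forall>m. 0 < p m \<and> p m \<le> 1) \<longrightarrow>
    filterlim (\<lambda>m. p m * real m powr (1 / (real CARD('d) - 1))) at_top sequentially \<longrightarrow>
    (\<lambda>m. prob_P2 m (p m)
       {Q :: (real^'d) set. hausdorff_distance (frontier Q) (sphere 0 1) \<le>
          ennreal (C * ((ln (p m * real m))\<^sup>2 * ln (real m) powr (2 / (real CARD('d) - 1))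
                          / ((p m)\<^sup>2 * real m powr (2 / (real CARD('d) - 1)))
                        + (ln (p m * real m ^ CARD('d)) / real m) powr (2 / (real CARD('d) - 1))))})
      \<longlonglongrightarrow> 1"
proof -
  define D where "D = CARD('d)"
  define \<alpha> where "\<alpha> = 1 / (real D - 1)"
  define R where "R = (64::real) ^ D"
  \<comment> \<open>Matches the hypothesis on \<open>b\<close> in
    \<open>prob_P2_hausdorff_ge\<close> and depends on the dimension only.\<close>
  define C where "C = 4800 * (2 * real D * R)\<^sup>2"
  have dim: "D \<ge> 2" and DIM: "DIM(real^'d) = D" using assms by (simp_all add: D_def)
  have \<alpha>: "0 < \<alpha>" "\<alpha> \<le> 1" using dim by (auto simp: \<alpha>_def)
  have R1: "R \<ge> 1" by (simp add: R_def)
  have C0: "C > 0" using dim R1 by (simp add: C_def)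
  show ?thesis unfolding D_def[symmetric]
  proof (intro exI[of _ C] conjI allI impI)
    fix p :: "nat \<Rightarrow> real"
    assume p: "\<forall>m. 0 < p m \<and> p m \<le> 1"
      and "filterlim (\<lambda>m. p m * real m powr (1 / (real D - 1))) at_top sequentially"
    then have lim: "filterlim (\<lambda>m. p m * real m powr \<alpha>) at_top sequentially" by (simp add: \<alpha>_def)
    define T where "T m = (ln (p m * real m))\<^sup>2 * ln (real m) powr (2 / (real D - 1))
                          / ((p m)\<^sup>2 * real m powr (2 / (real D - 1)))
                        + (ln (p m * real m ^ D) / real m) powr (2 / (real D - 1))" for m
    define E where "E m = {Q :: (real^'d) set. hausdorff_distance (frontier Q) (sphere 0 1) \<le> ennreal (C * T m)}" for m
    define \<epsilon> where "\<epsilon> m = 16 ^ D / (p m * m) + exp (- (p m * m powr \<alpha>) / (1296 * R\<^sup>2))" for m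
    \<comment> \<open>As \<open>\<alpha> \<le> 1\<close>, the growth hypothesis also drives
      \<open>p m * m\<close> to infinity.\<close>
    have "eventually (\<lambda>m. p m * real m powr \<alpha> \<le> p m * real m) sequentially"
      using eventually_ge_at_top[of 1]
    proof eventually_elim
      case (elim m)
      have "real m powr \<alpha> \<le> real m powr 1" using elim \<alpha> by (intro powr_mono) auto
      then show ?case using p elim by (intro mult_left_mono) (auto simp: less_imp_le)
    qed
    then have pm: "filterlim (\<lambda>m. p m * real m) at_top sequentially"
      by (rule filterlim_at_top_mono[OF lim])
    have \<epsilon>: "\<epsilon> \<longlonglongrightarrow> 0"
    proof -
      have "(\<lambda>m. 16 ^ D / (p m * m)) \<longlonglongrightarrow> 0"
        by (rule tendsto_divide_0[OF tendsto_const]) (rule filterlim_at_top_imp_at_infinity[OF pm])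
      moreover have "(\<lambda>m. exp (- (p m * m powr \<alpha>) / (1296 * R\<^sup>2))) \<longlonglongrightarrow> 0"
      proof -
        have "filterlim (\<lambda>m. 1 / (1296 * R\<^sup>2) * (p m * m powr \<alpha>)) at_top sequentially"
          using R1 by (intro filterlim_tendsto_pos_mult_at_top[OF tendsto_const _ lim]) auto
        then have "filterlim (\<lambda>m. - (1 / (1296 * R\<^sup>2) * (p m * m powr \<alpha>))) at_bot sequentially"
          by (simp add: filterlim_uminus_at_bot)
        then have "(\<lambda>m. exp (- (1 / (1296 * R\<^sup>2) * (p m * m powr \<alpha>)))) \<longlonglongrightarrow> 0"
          by (rule filterlim_compose[OF exp_at_bot])
        then show ?thesis by simp
      qed
      ultimately show ?thesis unfolding \<epsilon>_def by (intro tendsto_add_zero)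
    qed
    have low: "eventually (\<lambda>m. ennreal ((1 - \<epsilon> m) * (1 - 16 ^ D / m)) \<le> prob_P2 m (p m) (E m)) sequentially"
    proof -
      have "eventually (\<lambda>m. 1 \<le> ln (real m)) sequentially" by real_asymp
      moreover have "eventually (\<lambda>m. exp 1 \<le> p m * real m) sequentially"
        using pm by (auto simp: filterlim_at_top)
      moreover have "eventually (\<lambda>m. (ln (real m))\<^sup>2 \<le> real m) sequentially" by real_asymp
      moreover have "eventually (\<lambda>m. R * (ln (real m) / real m) powr \<alpha> \<le> 1 / 36) sequentially"
      proof -
        have "(\<lambda>m. ln (real m) / real m) \<longlonglongrightarrow> 0" by real_asymp
        then have "(\<lambda>m. (ln (real m) / real m) powr \<alpha>) \<longlonglongrightarrow> 0"
        proof (rule tendsto_zero_powrI[OF _ tendsto_const])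
          show "eventually (\<lambda>m. 0 \<le> ln (real m) / real m) sequentially" by real_asymp
        qed (use \<alpha> in auto)
        from tendsto_mult_right_zero[OF this, of R]
        have "eventually (\<lambda>m. R * (ln (real m) / real m) powr \<alpha> < 1 / 36) sequentially"
          by (rule order_tendstoD) simp
        then show ?thesis by (rule eventually_mono) simp
      qed
      moreover have "eventually (\<lambda>m. \<epsilon> m < 1) sequentially" using \<epsilon> by (rule order_tendstoD) simp
      ultimately show ?thesis
      proof eventually_elim
        case (elim m)
        define L where "L = (ln (real m) / real m) powr \<alpha>"
        have m: "real m > 0" using elim(1) by (cases "m = 0") auto
        have ln1: "1 \<le> ln (p m * m)" using elim(2) ln_le_cancel_iff[of "exp 1" "p m * m"]
          by (metis exp_gt_zero ln_exp order_less_le_trans)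
        \<comment> \<open>The first summand of \<open>T m\<close> is exactly the square of
          \<open>ln (p m * m) * L / p m\<close>, and \<open>powr\<close> is nonnegative, so
          \<open>T m\<close> is at least this square.\<close>
        have "4800 * (2 * real D * R * (ln (p m * m) * L / p m))\<^sup>2 \<le> C * T m"
        proof -
          have "L\<^sup>2 = ln (real m) powr (2 / (real D - 1)) / real m powr (2 / (real D - 1))"
          proof -
            have "L\<^sup>2 = (ln (real m) / real m) powr (2 * \<alpha>)"
              using powr_add[of "ln (real m) / real m" \<alpha> \<alpha>] by (simp add: L_def power2_eq_square)
            also have "\<dots> = ln (real m) powr (2 * \<alpha>) / real m powr (2 * \<alpha>)"
              by (rule powr_divide)
            finally show ?thesis by (simp add: \<alpha>_def)
          qed
          then have "(ln (p m * m) * L / p m)\<^sup>2 = (ln (p m * real m))\<^sup>2 * ln (real m) powr (2 / (real D - 1))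
                          / ((p m)\<^sup>2 * real m powr (2 / (real D - 1)))"
            by (simp add: power_mult_distrib power_divide)
          also have "\<dots> \<le> T m" by (simp add: T_def)
          finally have "C * (ln (p m * m) * L / p m)\<^sup>2 \<le> C * T m" using C0 by (intro mult_left_mono) auto
          moreover have "4800 * (2 * real D * R * (ln (p m * m) * L / p m))\<^sup>2 = C * (ln (p m * m) * L / p m)\<^sup>2"
            unfolding C_def power_mult_distrib[of "2 * real D * R"] by (rule mult.assoc[symmetric])
          ultimately show ?thesis by (simp only:)
        qed
        then show ?case
          using prob_P2_hausdorff_ge[where 'a = "real^'d", of "p m" m "C * T m"] p elim ln1 dim
          unfolding DIM \<alpha>_def[symmetric] R_def[symmetric] L_def[symmetric] \<epsilon>_def[symmetric] E_def
          by (simp add: less_imp_le)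
      qed
    qed
    have low_lim: "(\<lambda>m. ennreal ((1 - \<epsilon> m) * (1 - 16 ^ D / m))) \<longlonglongrightarrow> 1"
    proof -
      have "(\<lambda>m. 1 - 16 ^ D / real m) \<longlonglongrightarrow> 1" by real_asymp
      moreover have "(\<lambda>m. 1 - \<epsilon> m) \<longlonglongrightarrow> 1" using tendsto_diff[OF tendsto_const \<epsilon>, of 1] by simp
      ultimately have "(\<lambda>m. (1 - \<epsilon> m) * (1 - 16 ^ D / real m)) \<longlonglongrightarrow> 1"
        using tendsto_mult[of "\<lambda>m. 1 - \<epsilon> m" 1 sequentially "\<lambda>m. 1 - 16 ^ D / real m" 1] by simp
      from tendsto_ennrealI[OF this] show ?thesis by simp
    qed
    have "(\<lambda>m. prob_P2 m (p m) (E m)) \<longlonglongrightarrow> 1"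
      by (rule tendsto_sandwich[OF low _ low_lim tendsto_const]) (simp add: prob_P2_le_1)
    then show "(\<lambda>m. prob_P2 m (p m)
       {Q :: (real^'d) set. hausdorff_distance (frontier Q) (sphere 0 1) \<le>
          ennreal (C * ((ln (p m * real m))\<^sup>2 * ln (real m) powr (2 / (real D - 1))
                          / ((p m)\<^sup>2 * real m powr (2 / (real D - 1)))
                        + (ln (p m * real m ^ D) / real m) powr (2 / (real D - 1))))})
      \<longlonglongrightarrow> 1"
      unfolding E_def T_def .
  qed (rule C0)
qed

end
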